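(* Assume every $(\sigma,\delta)$-conjugacy class of $\mathbb{F}$ is algebraic. Let $a\in\mathbb{F}$, $r\in\mathbb{Z}_+$, let $P=F_{C^{\sigma,\delta}(a)}$, and let $a_1,\dots,a_m\in C^{\sigma,\delta}(a)$ form a P-basis of $C^{\sigma,\delta}(a)$. Then: (1) if $\mathbf b=(b_1,\dots,b_r)$ is a $(\sigma,\delta)$-multiplicity sequence with $b_1\in C^{\sigma,\delta}(a)$, then $P_{\mathbf b}$ divides $P^r$ on the right; (2) if $\mathbf a_i=(a_{i,1},\dots,a_{i,r})$ are $(\sigma,\delta)$-multiplicity sequences with $a_{i,1}=a_i$ ($i=1,\dots,m$) and $\Omega=\{P_{\mathbf a_1},\dots,P_{\mathbf a_m}\}$, then $F_\Omega=P^r$; (3) the set $C^{\sigma,\delta}_r(a)=\{P_{\mathbf b}:\mathbf b\in\mathbb{F}^i\text{ a }(\sigma,\delta)\text{-multiplicity sequence},\ b_1\in C^{\sigma,\delta}(a),\ 1\le i\le r\}\subseteq\mathcal U_2$ is P-closed in $\mathcal U_2$, has minimal skew polynomial $P^r$, has $\Omega$ (from (2)) as a P-basis, and its rank $\deg(P^r)$ equals $r\cdot\deg(F_{C^{\sigma,\delta}(a)})$.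
   Context: Let $\mathbb{F}$ be a division ring, $\sigma$ a ring endomorphism and $\delta$ a $\sigma$-derivation; $\mathbb{F}[x;\sigma,\delta]$ is the skew polynomial ring with $xa=\sigma(a)x+\delta(a)$. Conjugation $a^\beta=\sigma(\beta)a\beta^{-1}+\delta(\beta)\beta^{-1}$, $C^{\sigma,\delta}(a)=\{a^\beta:\beta\in\mathbb{F}^*\}$. For $\mathbf a=(a_1,\dots,a_r)$, $P_{\mathbf a}=(x-a_r)\cdots(x-a_1)$; $\mathbf a$ is a $(\sigma,\delta)$-multiplicity sequence if $a_1$ is the only $b$ with $x-b$ right-dividing $P_{\mathbf a}$. $\mathcal U_2$ is the set of all $P_{\mathbf a}$ with $\mathbf a$ a multiplicity sequence of any length $\ge1$. For a set $\Omega$ of skew polynomials, $I(\Omega)$ is the left ideal of skew polynomials right-divisible by all elements of $\Omega$, $F_\Omega$ its monic generator of minimal degree (or $0$); for $S\subseteq\mathbb{F}$, $F_S=F_{\{x-b:b\in S\}}$; $S$ or $\Omega$ is algebraic if $I\ne\{0\}$. $\Omega$ is P-independent if finite, algebraic and $\deg F_\Omega=\sum_{Q\in\Omega}\deg Q$. For $A\subseteq\mathbb{F}[x;\sigma,\delta]$, $Z_{\mathcal U_2}(A)=\{Q\in\mathcal U_2: Q\text{ right-divides every }F\in A\}$; $\Omega\subseteq\mathcal U_2$ is P-closed if $Z_{\mathcal U_2}(I(\Omega))=\Omega$. For a P-closed $\Omega'$, a P-basis is a P-independent set $\mathcal B$ with $\mathcal B\le\Omega'$ and $Z_{\mathcal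 U_2}(I(\mathcal B))=\Omega'$, where $\Psi\le\Omega'$ means every finite subset $\{Q_1,\dots,Q_n\}$ of $\Psi$ of size $n$ admits $\{P_1,\dots,P_n\}\subseteq\Omega'$ of size $n$ with $Q_i$ right-dividing $P_i$. For $C^{\sigma,\delta}(a)\subseteq\mathbb{F}$, a P-basis is a P-independent finite subset $\{a_1,\dots,a_m\}$ with $F_{\{a_1,\dots,a_m\}}=F_{C^{\sigma,\delta}(a)}$. The rank of a P-closed set is the degree of its minimal skew polynomial. *)

theory Defs
  imports "HOL-Computational_Algebra.Polynomial"
begin

text \<open>Skew polynomial ring F[x; sigma, delta] over a division ring. A skew polynomial
  sum c_i x^i (coefficients on the left) is represented by the ordinary 'a poly with
  coeff p i = c_i; only the multiplication is replaced by the skew multiplication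
  determined by x a = sigma(a) x + delta(a).\<close>

definition sk_endo :: "('a::division_ring \<Rightarrow> 'a) \<Rightarrow> bool" where
  "sk_endo \<sigma> \<longleftrightarrow> (\<forall>x y. \<sigma> (x + y) = \<sigma> x + \<sigma> y) \<and> (\<forall>x y. \<sigma> (x * y) = \<sigma> x * \<sigma> y) \<and> \<sigma> 1 = 1"

definition sk_sder :: "('a::division_ring \<Rightarrow> 'a) \<Rightarrow> ('a \<Rightarrow> 'a) \<Rightarrow> bool" where
  "sk_sder \<sigma> \<delta> \<longleftrightarrow> (\<forall>x y. \<delta> (x + y) = \<delta> x + \<delta> y) \<and> (\<forall>x y. \<delta> (x * y) = \<sigma> x * \<delta> y + \<delta> x * y)"

definition sk_xmul :: "('a::division_ring \<Rightarrow> 'a) \<Rightarrow> ('a \<Rightarrow> 'a) \<Rightarrow> 'a poly \<Rightarrow> 'a poly" where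
  "sk_xmul \<sigma> \<delta> q = pCons 0 (map_poly \<sigma> q) + map_poly \<delta> q"

definition sk_mult :: "('a::division_ring \<Rightarrow> 'a) \<Rightarrow> ('a \<Rightarrow> 'a) \<Rightarrow> 'a poly \<Rightarrow> 'a poly \<Rightarrow> 'a poly" where
  "sk_mult \<sigma> \<delta> p q = (\<Sum>i\<le>degree p. map_poly (\<lambda>c. coeff p i * c) ((sk_xmul \<sigma> \<delta> ^^ i) q))"

definition sk_pow :: "('a::division_ring \<Rightarrow> 'a) \<Rightarrow> ('a \<Rightarrow> 'a) \<Rightarrow> 'a poly \<Rightarrow> nat \<Rightarrow> 'a poly" where
  "sk_pow \<sigma> \<delta> P n = (sk_mult \<sigma> \<delta> P ^^ n) [:1:]"

definition sk_rdvd :: "('a::division_ring \<Rightarrow> 'a) \<Rightarrow> ('a \<Rightarrow> 'a) \<Rightarrow> 'a poly \<Rightarrow> 'a poly \<Rightarrow> bool" where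
  "sk_rdvd \<sigma> \<delta> Q F \<longleftrightarrow> (\<exists>G. F = sk_mult \<sigma> \<delta> G Q)"

definition sk_lin :: "'a::division_ring \<Rightarrow> 'a poly" where
  "sk_lin b = [:- b, 1:]"

definition sk_Pseq :: "('a::division_ring \<Rightarrow> 'a) \<Rightarrow> ('a \<Rightarrow> 'a) \<Rightarrow> 'a list \<Rightarrow> 'a poly" where
  "sk_Pseq \<sigma> \<delta> bs = fold (\<lambda>b P. sk_mult \<sigma> \<delta> (sk_lin b) P) bs [:1:]"

definition sk_mseq :: "('a::division_ring \<Rightarrow> 'a) \<Rightarrow> ('a \<Rightarrow> 'a) \<Rightarrow> 'a list \<Rightarrow> bool" where
  "sk_mseq \<sigma> \<delta> bs \<longleftrightarrow> bs \<noteq> [] \<and> (\<forall>b. sk_rdvd \<sigma> \<delta> (sk_lin b) (sk_Pseq \<sigma> \<delta> bs) \<longleftrightarrow> b = hd bs)"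

definition sk_U2 :: "('a::division_ring \<Rightarrow> 'a) \<Rightarrow> ('a \<Rightarrow> 'a) \<Rightarrow> 'a poly set" where
  "sk_U2 \<sigma> \<delta> = {sk_Pseq \<sigma> \<delta> bs | bs. sk_mseq \<sigma> \<delta> bs}"

definition sk_I :: "('a::division_ring \<Rightarrow> 'a) \<Rightarrow> ('a \<Rightarrow> 'a) \<Rightarrow> 'a poly set \<Rightarrow> 'a poly set" where
  "sk_I \<sigma> \<delta> \<Omega> = {F. \<forall>Q\<in>\<Omega>. sk_rdvd \<sigma> \<delta> Q F}"

definition sk_min :: "('a::division_ring \<Rightarrow> 'a) \<Rightarrow> ('a \<Rightarrow> 'a) \<Rightarrow> 'a poly set \<Rightarrow> 'a poly" where
  "sk_min \<sigma> \<delta> \<Omega> = (if sk_I \<sigma> \<delta> \<Omega> = {0} then 0 else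
     (THE F. F \<in> sk_I \<sigma> \<delta> \<Omega> \<and> lead_coeff F = 1 \<and> (\<forall>G\<in>sk_I \<sigma> \<delta> \<Omega>. sk_rdvd \<sigma> \<delta> F G)))"

definition sk_minS :: "('a::division_ring \<Rightarrow> 'a) \<Rightarrow> ('a \<Rightarrow> 'a) \<Rightarrow> 'a set \<Rightarrow> 'a poly" where
  "sk_minS \<sigma> \<delta> S = sk_min \<sigma> \<delta> (sk_lin ` S)"

definition sk_algebraic :: "('a::division_ring \<Rightarrow> 'a) \<Rightarrow> ('a \<Rightarrow> 'a) \<Rightarrow> 'a poly set \<Rightarrow> bool" where
  "sk_algebraic \<sigma> \<delta> \<Omega> \<longleftrightarrow> sk_I \<sigma> \<delta> \<Omega> \<noteq> {0}"

definition sk_Pindep :: "('a::division_ring \<Rightarrow> 'a) \<Rightarrow> ('a \<Rightarrow> 'a) \<Rightarrow> 'a poly set \<Rightarrow> bool" where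
  "sk_Pindep \<sigma> \<delta> \<Omega> \<longleftrightarrow> finite \<Omega> \<and> sk_algebraic \<sigma> \<delta> \<Omega> \<and>
     degree (sk_min \<sigma> \<delta> \<Omega>) = (\<Sum>Q\<in>\<Omega>. degree Q)"

definition sk_Z :: "('a::division_ring \<Rightarrow> 'a) \<Rightarrow> ('a \<Rightarrow> 'a) \<Rightarrow> 'a poly set \<Rightarrow> 'a poly set" where
  "sk_Z \<sigma> \<delta> A = {Q \<in> sk_U2 \<sigma> \<delta>. \<forall>F\<in>A. sk_rdvd \<sigma> \<delta> Q F}"

definition sk_Pclosed :: "('a::division_ring \<Rightarrow> 'a) \<Rightarrow> ('a \<Rightarrow> 'a) \<Rightarrow> 'a poly set \<Rightarrow> bool" where
  "sk_Pclosed \<sigma> \<delta> \<Omega> \<longleftrightarrow> \<Omega> \<subseteq> sk_U2 \<sigma> \<delta> \<and> sk_Z \<sigma> \<delta> (sk_I \<sigma> \<delta> \<Omega>) = \<Omega>"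

definition sk_le :: "('a::division_ring \<Rightarrow> 'a) \<Rightarrow> ('a \<Rightarrow> 'a) \<Rightarrow> 'a poly set \<Rightarrow> 'a poly set \<Rightarrow> bool" where
  "sk_le \<sigma> \<delta> \<Psi> \<Omega>' \<longleftrightarrow> (\<forall>S. S \<subseteq> \<Psi> \<and> finite S \<longrightarrow>
     (\<exists>f. inj_on f S \<and> f ` S \<subseteq> \<Omega>' \<and> (\<forall>Q\<in>S. sk_rdvd \<sigma> \<delta> Q (f Q))))"

definition sk_Pbasis :: "('a::division_ring \<Rightarrow> 'a) \<Rightarrow> ('a \<Rightarrow> 'a) \<Rightarrow> 'a poly set \<Rightarrow> 'a poly set \<Rightarrow> bool" where
  "sk_Pbasis \<sigma> \<delta> B \<Omega>' \<longleftrightarrow> sk_Pindep \<sigma> \<delta> B \<and> sk_le \<sigma> \<delta> B \<Omega>' \<and> sk_Z \<sigma> \<delta> (sk_I \<sigma> \<delta> B) = \<Omega>'"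

definition sk_rank :: "('a::division_ring \<Rightarrow> 'a) \<Rightarrow> ('a \<Rightarrow> 'a) \<Rightarrow> 'a poly set \<Rightarrow> nat" where
  "sk_rank \<sigma> \<delta> \<Omega> = degree (sk_min \<sigma> \<delta> \<Omega>)"

definition sk_conj :: "('a::division_ring \<Rightarrow> 'a) \<Rightarrow> ('a \<Rightarrow> 'a) \<Rightarrow> 'a \<Rightarrow> 'a \<Rightarrow> 'a" where
  "sk_conj \<sigma> \<delta> \<beta> a = \<sigma> \<beta> * a * inverse \<beta> + \<delta> \<beta> * inverse \<beta>"

definition sk_C :: "('a::division_ring \<Rightarrow> 'a) \<Rightarrow> ('a \<Rightarrow> 'a) \<Rightarrow> 'a \<Rightarrow> 'a set" where
  "sk_C \<sigma> \<delta> a = {sk_conj \<sigma> \<delta> \<beta> a | \<beta>. \<beta> \<noteq> 0}"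

definition sk_Pbasis_class :: "('a::division_ring \<Rightarrow> 'a) \<Rightarrow> ('a \<Rightarrow> 'a) \<Rightarrow> 'a set \<Rightarrow> 'a \<Rightarrow> bool" where
  "sk_Pbasis_class \<sigma> \<delta> B a \<longleftrightarrow> B \<subseteq> sk_C \<sigma> \<delta> a \<and> finite B \<and> sk_Pindep \<sigma> \<delta> (sk_lin ` B) \<and>
     sk_minS \<sigma> \<delta> B = sk_minS \<sigma> \<delta> (sk_C \<sigma> \<delta> a)"

definition sk_Cr :: "('a::division_ring \<Rightarrow> 'a) \<Rightarrow> ('a \<Rightarrow> 'a) \<Rightarrow> nat \<Rightarrow> 'a \<Rightarrow> 'a poly set" where
  "sk_Cr \<sigma> \<delta> r a = {sk_Pseq \<sigma> \<delta> bs | bs. sk_mseq \<sigma> \<delta> bs \<and> hd bs \<in> sk_C \<sigma> \<delta> a \<and>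
     1 \<le> length bs \<and> length bs \<le> r}"

end

theory Submission
  imports Defs
begin

text \<open>Write \<open>R\<close> for the skew polynomial ring and \<open>P\<close> for the minimal polynomial of the class of \<open>a\<close>.
  By the product rule the left ideal \<open>RP\<close> of polynomials vanishing on the whole class is two-sided,
  so \<open>P^r\<close> is a left multiple of every product of \<open>r\<close> linear factors with roots in the class.
  The minimal polynomials of different classes are coprime and commute, which forces all entries of
  a multiplicity sequence into a single class; this gives part (1).

  For part (2), \<open>R/RP\<close> is semisimple, so the polynomial \<open>A\<close> of a multiplicity sequence with head \<open>b\<close>
  satisfies \<open>RP + RA = R(x - b)\<close>. As in Nakayama's lemma, P-independence of the heads then lifts to
  P-independence of the polynomials \<open>A\<close>, and the degree of their lclm is the sum of the lengths.

  For part (3), if the sequence of \<open>A\<close> could not be prolonged, then \<open>PA\<close> would right-divide the lclm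
  of \<open>P\<close> and \<open>A\<close>, whose degree is smaller because \<open>x - b\<close> right-divides both; so sequences of every
  length exist. Completing a given head to a P-basis of the class and counting degrees bounds the length of
  any multiplicity sequence whose polynomial right-divides \<open>P^r\<close>.\<close>

locale skew_poly =
  fixes \<sigma> \<delta> :: "'a::division_ring \<Rightarrow> 'a"
  assumes endo: "sk_endo \<sigma>" and sder: "sk_sder \<sigma> \<delta>"
begin

abbreviation skew_times :: "'a poly \<Rightarrow> 'a poly \<Rightarrow> 'a poly"  (infixl "\<odot>" 70)
  where "p \<odot> q \<equiv> sk_mult \<sigma> \<delta> p q"

abbreviation right_dvd :: "'a poly \<Rightarrow> 'a poly \<Rightarrow> bool"  (infix "rdvd" 50)
  where "q rdvd p \<equiv> sk_rdvd \<sigma> \<delta> q p"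

abbreviation xmul :: "'a poly \<Rightarrow> 'a poly"
  where "xmul \<equiv> sk_xmul \<sigma> \<delta>"

definition scal :: "'a \<Rightarrow> 'a poly \<Rightarrow> 'a poly"
  where "scal c p = map_poly (\<lambda>x. c * x) p"

section \<open>Consequences of the axioms for \<open>\<sigma>\<close> and
  \<open>\<delta>\<close>\<close>

lemma sigma_add: "\<sigma> (x + y) = \<sigma> x + \<sigma> y"
  and sigma_mult: "\<sigma> (x * y) = \<sigma> x * \<sigma> y"
  and sigma_1 [simp]: "\<sigma> 1 = 1"
  using endo unfolding sk_endo_def by blast+

lemma delta_add: "\<delta> (x + y) = \<delta> x + \<delta> y"
  and delta_mult: "\<delta> (x * y) = \<sigma> x * \<delta> y + \<delta> x * y"
  using sder unfolding sk_sder_def by blast+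

lemma sigma_0 [simp]: "\<sigma> 0 = 0"
  using sigma_add[of 0 0] by simp

lemma delta_0 [simp]: "\<delta> 0 = 0"
  using delta_add[of 0 0] by simp

lemma delta_1 [simp]: "\<delta> 1 = 0"
  using delta_mult[of 1 1] by simp

lemma sigma_eq_0_iff [simp]: "\<sigma> c = 0 \<longleftrightarrow> c = 0"
proof
  assume "\<sigma> c = 0"
  then have "c \<noteq> 0 \<Longrightarrow> \<sigma> (c * inverse c) = 0" by (simp only: sigma_mult) simp
  then show "c = 0" by (cases "c = 0") auto
qed simp

lemma sigma_funpow_eq_0_iff [simp]: "(\<sigma> ^^ n) c = 0 \<longleftrightarrow> c = 0"
  by (induction n) auto

lemma sigma_funpow_1 [simp]: "(\<sigma> ^^ n) 1 = 1"
  by (induction n) auto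

subsection \<open>Arithmetic of skew polynomials\<close>

lemma coeff_scal [simp]: "coeff (scal c p) n = c * coeff p n"
  by (simp add: scal_def coeff_map_poly)

lemma scal_pCons [simp]: "scal c (pCons d p) = pCons (c * d) (scal c p)"
  by (simp add: scal_def map_poly_pCons)

lemma scal_0_right [simp]: "scal c 0 = 0"
  by (simp add: scal_def)

lemma coeff_xmul: "coeff (xmul q) n = (if n = 0 then 0 else \<sigma> (coeff q (n - 1))) + \<delta> (coeff q n)"
  by (auto simp: sk_xmul_def coeff_map_poly coeff_pCons split: nat.split)

lemma xmul_add: "xmul (p + q) = xmul p + xmul q"
  by (rule poly_eqI) (simp add: coeff_xmul sigma_add delta_add)

lemma xmul_0 [simp]: "xmul 0 = 0"
  by (rule poly_eqI) (simp add: coeff_xmul)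

lemma xmul_scal: "xmul (scal c p) = scal (\<sigma> c) (xmul p) + scal (\<delta> c) p"
  by (rule poly_eqI) (simp add: coeff_xmul sigma_mult delta_mult distrib_left)

lemma xmul_funpow_add: "(xmul ^^ n) (p + q) = (xmul ^^ n) p + (xmul ^^ n) q"
  by (induction n) (simp_all add: xmul_add)

lemma xmul_funpow_0 [simp]: "(xmul ^^ n) 0 = 0"
  by (induction n) simp_all

lemma scal_add: "scal c (p + q) = scal c p + scal c q"
  by (rule poly_eqI) (simp add: distrib_left)

lemma scal_add_left: "scal (c + d) p = scal c p + scal d p"
  by (rule poly_eqI) (simp add: distrib_right)

lemma scal_scal: "scal c (scal d p) = scal (c * d) p"
  by (rule poly_eqI) (simp add: mult.assoc)

lemma scal_0 [simp]: "scal 0 p = 0"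
  by (rule poly_eqI) simp

lemma scal_1 [simp]: "scal 1 p = p"
  by (rule poly_eqI) simp

lemma skew_times_eq_sum:
  assumes "degree p \<le> n"
  shows "p \<odot> q = (\<Sum>i\<le>n. scal (coeff p i) ((xmul ^^ i) q))"
  unfolding sk_mult_def scal_def[symmetric]
proof (rule sum.mono_neutral_left)
  show "\<forall>i\<in>{..n} - {..degree p}. scal (coeff p i) ((xmul ^^ i) q) = 0"
    by (auto simp: coeff_eq_0)
qed (use assms in auto)

text \<open>Horner recursion: \<open>pCons c p\<close> stands for \<open>c + p x\<close>, and the
  \<open>x\<close> is passed on to \<open>q\<close>. Inductions on the left factor therefore keep
  the right factor arbitrary.\<close>

lemma skew_times_pCons [simp]: "pCons c p \<odot> q = scal c q + p \<odot> xmul q"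
proof -
  let ?n = "degree p"
  have "degree (pCons c p) \<le> Suc ?n" by (rule degree_pCons_le)
  from skew_times_eq_sum[OF this, of q]
  have "pCons c p \<odot> q = (\<Sum>i\<le>Suc ?n. scal (coeff (pCons c p) i) ((xmul ^^ i) q))" .
  also have "\<dots> = scal c q + (\<Sum>i\<le>?n. scal (coeff p i) ((xmul ^^ Suc i) q))"
    unfolding sum.atMost_Suc_shift by simp
  also have "(\<Sum>i\<le>?n. scal (coeff p i) ((xmul ^^ Suc i) q)) = p \<odot> xmul q"
    unfolding sk_mult_def scal_def by (simp only: funpow_Suc_right o_apply)
  finally show ?thesis .
qed

lemma skew_times_0_left [simp]: "0 \<odot> q = 0"
  using skew_times_eq_sum[of 0 0 q] by simp

lemma skew_times_0_right [simp]: "p \<odot> 0 = 0"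
  unfolding sk_mult_def by simp

lemma skew_times_1_left [simp]: "[:1:] \<odot> q = q"
  by simp

lemma skew_times_add_left: "(p + p') \<odot> q = p \<odot> q + p' \<odot> q"
proof -
  let ?n = "max (degree p) (degree p')"
  have "degree (p + p') \<le> ?n" by (rule degree_add_le_max)
  then show ?thesis
    by (simp add: skew_times_eq_sum[of _ ?n] scal_add_left sum.distrib)
qed

lemma skew_times_add_right: "p \<odot> (q + q') = p \<odot> q + p \<odot> q'"
  by (simp add: sk_mult_def scal_def[symmetric] xmul_funpow_add scal_add sum.distrib)

lemma skew_times_scal_left: "scal c p \<odot> q = scal c (p \<odot> q)"
  by (induction p arbitrary: q) (simp_all add: map_poly_pCons scal_scal scal_add)

lemma skew_times_diff_left: "(p - p') \<odot> q = p \<odot> q - p' \<odot> q"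
  using skew_times_add_left[of "p - p'" p' q] by simp

lemma skew_times_diff_right: "p \<odot> (q - q') = p \<odot> q - p \<odot> q'"
  using skew_times_add_right[of p "q - q'" q'] by simp

text \<open>Associativity for the left factor \<open>x\<close>; the general case reduces to it,
  since constants and \<open>x\<close> generate the ring.\<close>

lemma xmul_skew_times: "xmul (q \<odot> s) = xmul q \<odot> s"
proof -
  \<comment> \<open>With the \<open>\<sigma>\<close> and \<open>\<delta>\<close> parts of
    \<open>xmul q\<close> kept apart, induction on \<open>q\<close> goes through by
    \<open>xmul_scal\<close>.\<close>
  have "xmul (q \<odot> s) = map_poly \<sigma> q \<odot> xmul s + map_poly \<delta> q \<odot> s"
    by (induction q arbitrary: s) (simp_all add: map_poly_pCons xmul_add xmul_scal add_ac)
  then show ?thesis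
    by (simp add: sk_xmul_def[of \<sigma> \<delta> q] skew_times_add_left)
qed

lemma skew_times_assoc: "p \<odot> (q \<odot> s) = (p \<odot> q) \<odot> s"
  by (induction p arbitrary: q s)
    (simp_all add: skew_times_add_left skew_times_scal_left xmul_skew_times)

lemma xmul_funpow_1: "(xmul ^^ n) [:1:] = monom 1 n"
proof (induction n)
  case (Suc n)
  have "xmul (monom 1 n) = monom 1 (Suc n)"
    by (rule poly_eqI) (auto simp: coeff_xmul split: if_splits)
  with Suc show ?case by simp
qed (simp add: monom_0)

lemma skew_times_1_right [simp]: "p \<odot> [:1:] = p"
proof (rule poly_eqI)
  fix n
  have "coeff (p \<odot> [:1:]) n = (\<Sum>i\<le>degree p. if i = n then coeff p i else 0)"
    unfolding sk_mult_def scal_def[symmetric] xmul_funpow_1 coeff_sum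
    by (rule sum.cong) auto
  also have "\<dots> = coeff p n"
    by (auto simp: coeff_eq_0)
  finally show "coeff (p \<odot> [:1:]) n = coeff p n" .
qed

section \<open>Degrees, leading coefficients and right division\<close>

lemma degree_scal [simp]: "c \<noteq> 0 \<Longrightarrow> degree (scal c p) = degree p"
  by (simp add: degree_def)

lemma scal_eq_0_iff [simp]: "scal c p = 0 \<longleftrightarrow> c = 0 \<or> p = 0"
  by (auto simp: poly_eq_iff)

lemma degree_xmul: "q \<noteq> 0 \<Longrightarrow> degree (xmul q) = Suc (degree q)"
  by (rule antisym) (auto intro!: degree_le le_degree simp: coeff_xmul coeff_eq_0)

lemma xmul_eq_0_iff [simp]: "xmul q = 0 \<longleftrightarrow> q = 0"
  using degree_xmul[of q] by fastforce

text \<open>The top term comes from \<open>p \<odot> xmul q\<close>. It survives because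
  \<open>\<sigma>\<close> has trivial kernel and a division ring has no zero divisors.\<close>

lemma degree_skew_times_aux:
  assumes "p \<noteq> 0" "q \<noteq> 0"
  shows "p \<odot> q \<noteq> 0 \<and> degree (p \<odot> q) = degree p + degree q \<and>
    lead_coeff (p \<odot> q) = lead_coeff p * (\<sigma> ^^ degree p) (lead_coeff q)"
  using assms
proof (induction p arbitrary: q)
  case (pCons c p)
  show ?case
  proof (cases "p = 0")
    case True
    with pCons.hyps have "c \<noteq> 0" by auto
    with True pCons.prems show ?thesis by simp
  next
    case False
    have x: "xmul q \<noteq> 0" "degree (xmul q) = Suc (degree q)"
        "lead_coeff (xmul q) = \<sigma> (lead_coeff q)"
      using pCons.prems by (simp_all add: degree_xmul) (simp add: coeff_xmul coeff_eq_0)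
    from pCons.IH[OF False x(1)] x
    have IH: "p \<odot> xmul q \<noteq> 0" "degree (p \<odot> xmul q) = degree p + Suc (degree q)"
        "lead_coeff (p \<odot> xmul q) = lead_coeff p * (\<sigma> ^^ Suc (degree p)) (lead_coeff q)"
      by (auto simp: funpow_swap1)
    have "degree (scal c q) < degree (p \<odot> xmul q)"
      using IH(2) by (cases "c = 0") auto
    then have "degree (pCons c p \<odot> q) = degree (p \<odot> xmul q)"
        "lead_coeff (pCons c p \<odot> q) = lead_coeff (p \<odot> xmul q)"
      by (simp_all add: degree_add_eq_right coeff_eq_0 del: coeff_scal)
    with IH False show ?thesis
      by (auto simp: degree_pCons_eq)
  qed
qed simp

lemma skew_times_eq_0_iff [simp]: "p \<odot> q = 0 \<longleftrightarrow> p = 0 \<or> q = 0"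
  using degree_skew_times_aux by fastforce

lemma degree_skew_times: "p \<noteq> 0 \<Longrightarrow> q \<noteq> 0 \<Longrightarrow> degree (p \<odot> q) = degree p + degree q"
  using degree_skew_times_aux by blast

lemma lead_coeff_skew_times:
  "lead_coeff (p \<odot> q) = lead_coeff p * (\<sigma> ^^ degree p) (lead_coeff q)"
  using degree_skew_times_aux[of p q] by (cases "p = 0"; cases "q = 0") auto

lemma skew_times_right_cancel: "q \<noteq> 0 \<Longrightarrow> p \<odot> q = p' \<odot> q \<longleftrightarrow> p = p'"
  using skew_times_eq_0_iff[of "p - p'" q] by (auto simp: skew_times_diff_left)

lemma right_division:
  assumes "B \<noteq> 0"
  shows "\<exists>q R. A = q \<odot> B + R \<and> (R = 0 \<or> degree R < degree B)"
proof (induction "degree A" arbitrary: A rule: less_induct)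
  case less
  show ?case
  proof (cases "A = 0 \<or> degree A < degree B")
    case True
    then show ?thesis by (intro exI[of _ 0] exI[of _ A]) auto
  next
    case False
    define k where "k = degree A - degree B"
    \<comment> \<open>\<open>M \<odot> B\<close> has leading coefficient
      \<open>lead_coeff M * (\<sigma> ^^ k) (lead_coeff B)\<close>, so this monomial matches
      \<open>A\<close> in degree and leading coefficient.\<close>
    define M where "M = monom (lead_coeff A * inverse ((\<sigma> ^^ k) (lead_coeff B))) k"
    have c: "lead_coeff A * inverse ((\<sigma> ^^ k) (lead_coeff B)) \<noteq> 0"
      using False assms by simp
    then have M: "M \<noteq> 0" "degree M = k"
      by (simp_all add: M_def degree_monom_eq)
    have deg: "degree (M \<odot> B) = degree A"
      using False M assms by (simp add: degree_skew_times k_def)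
    have lead: "lead_coeff (M \<odot> B) = lead_coeff A"
      unfolding lead_coeff_skew_times M(2)
      using M(2) c assms by (simp add: M_def mult.assoc degree_monom_eq)
    have "A - M \<odot> B = 0 \<or> degree (A - M \<odot> B) < degree A"
    proof -
      have "coeff (A - M \<odot> B) (degree A) = 0"
        using deg lead by simp
      moreover have "degree (A - M \<odot> B) \<le> degree A"
        using deg by (intro degree_diff_le) auto
      ultimately show ?thesis
        by (metis le_neq_implies_less leading_coeff_0_iff)
    qed
    then obtain q R where "A - M \<odot> B = q \<odot> B + R" "R = 0 \<or> degree R < degree B"
      using less[of "A - M \<odot> B"] by (metis add.right_neutral skew_times_0_left)
    then have "A = (q + M) \<odot> B + R" "R = 0 \<or> degree R < degree B"
      by (simp_all add: skew_times_add_left algebra_simps)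
    then show ?thesis by blast
  qed
qed

subsection \<open>Right divisibility, greatest common right divisors, least common left multiples\<close>

lemma rdvd_refl [simp]: "A rdvd A"
  unfolding sk_rdvd_def by (metis skew_times_1_left)

lemma rdvd_trans [trans]: "A rdvd B \<Longrightarrow> B rdvd C \<Longrightarrow> A rdvd C"
  unfolding sk_rdvd_def by (metis skew_times_assoc)

lemma rdvd_0 [simp]: "A rdvd 0"
  unfolding sk_rdvd_def by (metis skew_times_0_left)

lemma rdvd_times [simp]: "A rdvd u \<odot> A"
  unfolding sk_rdvd_def by blast

lemma rdvd_times_left: "A rdvd B \<Longrightarrow> A rdvd u \<odot> B"
  using rdvd_trans rdvd_times by blast

lemma rdvd_add: "A rdvd B \<Longrightarrow> A rdvd C \<Longrightarrow> A rdvd B + C"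
  unfolding sk_rdvd_def by (metis skew_times_add_left)

lemma rdvd_diff: "A rdvd B \<Longrightarrow> A rdvd C \<Longrightarrow> A rdvd B - C"
  unfolding sk_rdvd_def by (metis skew_times_diff_left)

lemma rdvd_times_cancel: "C \<noteq> 0 \<Longrightarrow> A \<odot> C rdvd B \<odot> C \<longleftrightarrow> A rdvd B"
  unfolding sk_rdvd_def by (simp add: skew_times_assoc skew_times_right_cancel)

lemma rdvd_imp_times_rdvd_times: "A rdvd B \<Longrightarrow> A \<odot> C rdvd B \<odot> C"
  unfolding sk_rdvd_def by (metis skew_times_assoc)

lemma rdvd_imp_degree_le: "A rdvd B \<Longrightarrow> B \<noteq> 0 \<Longrightarrow> degree A \<le> degree B"
  unfolding sk_rdvd_def by (auto simp: degree_skew_times)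

lemma rdvd_const: "c \<noteq> 0 \<Longrightarrow> [:c:] rdvd A"
  unfolding sk_rdvd_def
  by (rule exI[of _ "A \<odot> [:inverse c:]"]) (simp add: skew_times_assoc[symmetric] del: skew_times_pCons, simp)

lemma rdvd_degree_0: "degree D = 0 \<Longrightarrow> D \<noteq> 0 \<Longrightarrow> D rdvd A"
  by (metis degree_0_id degree_eq_zeroE pCons_0_0 rdvd_const)

lemma rdvd_same_degree:
  assumes "A rdvd B" "B \<noteq> 0" "degree B \<le> degree A"
  shows "B rdvd A"
proof -
  from assms(1) obtain u where u: "B = u \<odot> A" unfolding sk_rdvd_def by blast
  with assms(2,3) have "u \<noteq> 0" "degree u = 0" by (auto simp: degree_skew_times)
  then obtain c where c: "u = [:c:]" "c \<noteq> 0" by (metis degree_eq_zeroE pCons_0_0)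
  have "A = [:inverse c:] \<odot> B"
    using c by (simp add: u scal_scal)
  then show ?thesis by (metis rdvd_times)
qed

lemma rdvd_same_degree_monic_eq:
  assumes "A rdvd B" "lead_coeff A = 1" "lead_coeff B = 1" "degree B \<le> degree A"
  shows "A = B"
proof -
  from assms(1) obtain u where u: "B = u \<odot> A" unfolding sk_rdvd_def by blast
  from assms(2,3) have "A \<noteq> 0" "B \<noteq> 0" by auto
  with u assms(4) have "u \<noteq> 0" "degree u = 0" by (auto simp: degree_skew_times)
  then obtain c where c: "u = [:c:]" by (metis degree_eq_zeroE)
  from assms(2,3) have "c = 1"
    unfolding u lead_coeff_skew_times by (simp add: c)
  then show ?thesis by (simp add: u c)
qed

text \<open>Comaximality of the two left ideals; the Bezout form is the one that
  \<open>two_sided_modular\<close> consumes.\<close>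

definition coprime_right :: "'a poly \<Rightarrow> 'a poly \<Rightarrow> bool"
  where "coprime_right A B \<longleftrightarrow> (\<exists>u v. u \<odot> A + v \<odot> B = [:1:])"

text \<open>The gcrd \<open>D\<close> and lclm \<open>L\<close> are built along the Euclidean algorithm: if \<open>A = q \<odot> B + R\<close>
  and \<open>s \<odot> R\<close> is an lclm of \<open>B\<close> and \<open>R\<close>, then \<open>s \<odot> A\<close> is one of \<open>A\<close> and \<open>B\<close>.\<close>

lemma gcrd_lclm:
  assumes "A \<noteq> 0" "B \<noteq> 0"
  shows "\<exists>D L u v. D rdvd A \<and> D rdvd B \<and> D = u \<odot> A + v \<odot> B \<and> D \<noteq> 0 \<and>
    A rdvd L \<and> B rdvd L \<and> (\<forall>F. A rdvd F \<longrightarrow> B rdvd F \<longrightarrow> L rdvd F) \<and> L \<noteq> 0 \<and>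
    degree D + degree L = degree A + degree B"
  using assms
proof (induction "degree B" arbitrary: A B rule: less_induct)
  case less
  obtain q R where qR: "A = q \<odot> B + R" "R = 0 \<or> degree R < degree B"
    using right_division[OF less.prems(2)] by blast
  show ?case
  proof (cases "R = 0")
    case True
    then have "B rdvd A" using qR by simp
    moreover have "B = 0 \<odot> A + [:1:] \<odot> B" by simp
    ultimately show ?thesis
      using less.prems by (metis add.commute rdvd_refl)
  next
    case False
    with qR(2) have "degree R < degree B" by simp
    from less.hyps[OF this less.prems(2) False]
    obtain D L u v where D: "D rdvd B" "D rdvd R" "D = u \<odot> B + v \<odot> R" "D \<noteq> 0"
      and L: "B rdvd L" "R rdvd L" "\<And>F. B rdvd F \<Longrightarrow> R rdvd F \<Longrightarrow> L rdvd F" "L \<noteq> 0"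
      and deg: "degree D + degree L = degree B + degree R"
      by blast
    obtain s where s: "L = s \<odot> R" using L(2) unfolding sk_rdvd_def by blast
    have s0: "s \<noteq> 0" using L(4) s by auto
    have R: "R = A - q \<odot> B" using qR by simp
    have "D rdvd A" using D qR by (simp add: rdvd_add rdvd_times_left)
    moreover have "D = v \<odot> A + (u - v \<odot> q) \<odot> B"
      unfolding D(3) by (simp add: R skew_times_diff_right skew_times_diff_left skew_times_assoc)
    moreover have "B rdvd s \<odot> A"
      using L(1) unfolding qR(1) s by (simp add: skew_times_add_right rdvd_add rdvd_times_left)
    moreover have "s \<odot> A rdvd F" if F: "A rdvd F" "B rdvd F" for F
    proof -
      obtain \<alpha> where \<alpha>: "F = \<alpha> \<odot> A" using F unfolding sk_rdvd_def by blast
      \<comment> \<open>Replacing \<open>A\<close> by \<open>R\<close> changes \<open>F\<close> only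
        by a left multiple of \<open>B\<close>, so the lclm of \<open>B\<close> and \<open>R\<close>
        applies and \<open>R\<close> cancels on the right.\<close>
      have "\<alpha> \<odot> R = F - \<alpha> \<odot> q \<odot> B"
        by (simp add: R \<alpha> skew_times_diff_right skew_times_assoc)
      then have "B rdvd \<alpha> \<odot> R" using F by (simp add: rdvd_diff)
      then have "s \<odot> R rdvd \<alpha> \<odot> R" using L(3)[of "\<alpha> \<odot> R"] s by simp
      then have "s rdvd \<alpha>" using False by (simp add: rdvd_times_cancel)
      then show ?thesis unfolding \<alpha> by (rule rdvd_imp_times_rdvd_times)
    qed
    moreover have "s \<odot> A \<noteq> 0" "degree D + degree (s \<odot> A) = degree A + degree B"
      using s0 less.prems False deg by (simp_all add: s degree_skew_times)
    ultimately show ?thesis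
      using D(1,4) rdvd_times[of A s] by blast
  qed
qed

lemma coprime_rightI:
  assumes "A \<noteq> 0" "B \<noteq> 0" "\<And>D. D rdvd A \<Longrightarrow> D rdvd B \<Longrightarrow> degree D = 0"
  shows "coprime_right A B"
proof -
  obtain D u v where D: "D rdvd A" "D rdvd B" "D = u \<odot> A + v \<odot> B" "D \<noteq> 0"
    using gcrd_lclm[OF assms(1,2)] by blast
  have "degree D = 0" using assms(3)[OF D(1,2)] .
  then have "D rdvd [:1:]" using D(4) by (rule rdvd_degree_0)
  then obtain w where "[:1:] = w \<odot> D" unfolding sk_rdvd_def by blast
  then have "(w \<odot> u) \<odot> A + (w \<odot> v) \<odot> B = [:1:]"
    by (simp add: D(3) skew_times_add_right skew_times_assoc)
  then show ?thesis unfolding coprime_right_def by blast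
qed

lemma coprime_right_common_divisor:
  assumes "coprime_right A B" "D rdvd A" "D rdvd B"
  shows "degree D = 0"
proof -
  have "D rdvd [:1:]"
    using assms unfolding coprime_right_def by (metis rdvd_add rdvd_times_left)
  then show ?thesis using rdvd_imp_degree_le by fastforce
qed

lemma coprime_right_lclm:
  assumes "A \<noteq> 0" "B \<noteq> 0" "coprime_right A B"
  shows "\<exists>L. A rdvd L \<and> B rdvd L \<and> (\<forall>F. A rdvd F \<longrightarrow> B rdvd F \<longrightarrow> L rdvd F) \<and> L \<noteq> 0 \<and>
    degree L = degree A + degree B"
proof -
  obtain D L where D: "D rdvd A" "D rdvd B"
    and L: "A rdvd L" "B rdvd L" "\<And>F. A rdvd F \<Longrightarrow> B rdvd F \<Longrightarrow> L rdvd F" "L \<noteq> 0"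
    and deg: "degree D + degree L = degree A + degree B"
    using gcrd_lclm[OF assms(1,2)] by blast
  have "degree D = 0" using coprime_right_common_divisor assms(3) D by blast
  with deg L show ?thesis by (intro exI[of _ L]) simp
qed

subsection \<open>Monic generators of left ideals\<close>

lemma sk_I_iff: "F \<in> sk_I \<sigma> \<delta> \<Omega> \<longleftrightarrow> (\<forall>Q\<in>\<Omega>. Q rdvd F)"
  by (simp add: sk_I_def)

lemma sk_algebraic_iff: "sk_algebraic \<sigma> \<delta> \<Omega> \<longleftrightarrow> (\<exists>F. F \<noteq> 0 \<and> (\<forall>Q\<in>\<Omega>. Q rdvd F))"
proof -
  have "0 \<in> sk_I \<sigma> \<delta> \<Omega>" by (simp add: sk_I_iff)
  then have "sk_I \<sigma> \<delta> \<Omega> \<noteq> {0} \<longleftrightarrow> (\<exists>F\<in>sk_I \<sigma> \<delta> \<Omega>. F \<noteq> 0)" by auto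
  then show ?thesis unfolding sk_algebraic_def by (auto simp: sk_I_iff)
qed

text \<open>A nonzero common left multiple of least degree, scaled to be monic, generates the left
  ideal by right division. Two monic generators have equal degree and agree, so the
  \<open>THE\<close> in \<open>sk_min\<close> is well defined.\<close>

lemma sk_min_aux:
  assumes "sk_algebraic \<sigma> \<delta> \<Omega>"
  shows "sk_min \<sigma> \<delta> \<Omega> \<in> sk_I \<sigma> \<delta> \<Omega> \<and> lead_coeff (sk_min \<sigma> \<delta> \<Omega>) = 1 \<and>
    (\<forall>G\<in>sk_I \<sigma> \<delta> \<Omega>. sk_min \<sigma> \<delta> \<Omega> rdvd G)"
proof -
  let ?P = "\<lambda>F. F \<in> sk_I \<sigma> \<delta> \<Omega> \<and> lead_coeff F = 1 \<and> (\<forall>G\<in>sk_I \<sigma> \<delta> \<Omega>. F rdvd G)"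
  obtain F0 where "F0 \<noteq> 0 \<and> F0 \<in> sk_I \<sigma> \<delta> \<Omega>"
    using assms by (auto simp: sk_algebraic_iff sk_I_iff)
  then obtain F where F: "F \<noteq> 0" "F \<in> sk_I \<sigma> \<delta> \<Omega>"
    and Fmin: "\<And>G. G \<noteq> 0 \<and> G \<in> sk_I \<sigma> \<delta> \<Omega> \<Longrightarrow> degree F \<le> degree G"
    using exists_least_iff[of "\<lambda>n. \<exists>F. (F \<noteq> 0 \<and> F \<in> sk_I \<sigma> \<delta> \<Omega>) \<and> degree F = n"]
    by (metis (mono_tags, lifting) linorder_not_less)
  define E where "E = [:inverse (lead_coeff F):] \<odot> F"
  have "?P E"
  proof (intro conjI ballI)
    show "E \<in> sk_I \<sigma> \<delta> \<Omega>"
      using F(2) unfolding E_def sk_I_iff by (blast intro: rdvd_times_left)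
    show "lead_coeff E = 1"
      unfolding E_def lead_coeff_skew_times using F(1) by simp
    fix G assume G: "G \<in> sk_I \<sigma> \<delta> \<Omega>"
    have "E rdvd F"
      using F(1) unfolding E_def sk_rdvd_def
      by (intro exI[of _ "[:lead_coeff F:]"]) (simp add: scal_scal)
    obtain q R where qR: "G = q \<odot> F + R" "R = 0 \<or> degree R < degree F"
      using right_division[OF F(1)] by blast
    then have "R = G - q \<odot> F" by simp
    then have "R \<in> sk_I \<sigma> \<delta> \<Omega>"
      using G F(2) unfolding sk_I_iff by (simp add: rdvd_diff rdvd_times_left)
    then have "R = 0" using qR(2) Fmin[of R] by (metis leD)
    then show "E rdvd G" using qR(1) \<open>E rdvd F\<close> by (simp add: rdvd_times_left)
  qed
  moreover have "F = E" if "?P F" for F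
  proof (rule rdvd_same_degree_monic_eq)
    show "degree E \<le> degree F"
      using that \<open>?P E\<close> by (intro rdvd_imp_degree_le) auto
  qed (use that \<open>?P E\<close> in auto)
  ultimately have "?P (THE F. ?P F)" by (rule theI)
  then show ?thesis
    using assms unfolding sk_min_def sk_algebraic_def by simp
qed

lemma rdvd_sk_min: "sk_algebraic \<sigma> \<delta> \<Omega> \<Longrightarrow> Q \<in> \<Omega> \<Longrightarrow> Q rdvd sk_min \<sigma> \<delta> \<Omega>"
  using sk_min_aux sk_I_iff by blast

lemma lead_coeff_sk_min: "sk_algebraic \<sigma> \<delta> \<Omega> \<Longrightarrow> lead_coeff (sk_min \<sigma> \<delta> \<Omega>) = 1"
  using sk_min_aux by blast

lemma sk_min_rdvd: "sk_algebraic \<sigma> \<delta> \<Omega> \<Longrightarrow> (\<And>Q. Q \<in> \<Omega> \<Longrightarrow> Q rdvd F) \<Longrightarrow> sk_min \<sigma> \<delta> \<Omega> rdvd F"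
  using sk_min_aux sk_I_iff by blast

lemma sk_min_eqI:
  assumes "lead_coeff F = 1" "\<And>Q. Q \<in> \<Omega> \<Longrightarrow> Q rdvd F"
    "\<And>G. (\<And>Q. Q \<in> \<Omega> \<Longrightarrow> Q rdvd G) \<Longrightarrow> F rdvd G"
  shows "sk_min \<sigma> \<delta> \<Omega> = F"
proof -
  have alg: "sk_algebraic \<sigma> \<delta> \<Omega>"
    unfolding sk_algebraic_iff using assms(1,2) by (intro exI[of _ F]) auto
  have "F rdvd sk_min \<sigma> \<delta> \<Omega>" using alg by (intro assms(3) rdvd_sk_min)
  moreover have "sk_min \<sigma> \<delta> \<Omega> \<noteq> 0" using lead_coeff_sk_min[OF alg] by auto
  ultimately have "degree F \<le> degree (sk_min \<sigma> \<delta> \<Omega>)" by (rule rdvd_imp_degree_le)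
  then show ?thesis
    using assms alg by (intro rdvd_same_degree_monic_eq sk_min_rdvd lead_coeff_sk_min)
qed

subsection \<open>Linear factors and conjugacy\<close>

lemma degree_sk_lin [simp]: "degree (sk_lin b) = 1"
  and sk_lin_neq_0 [simp]: "sk_lin b \<noteq> 0"
  and lead_coeff_sk_lin [simp]: "coeff (sk_lin b) (Suc 0) = 1"
  by (simp_all add: sk_lin_def)

lemma sk_lin_eq_iff [simp]: "sk_lin b = sk_lin c \<longleftrightarrow> b = c"
  by (simp add: sk_lin_def)

lemma sk_lin_rdvd_sk_lin_iff [simp]: "sk_lin b rdvd sk_lin c \<longleftrightarrow> b = c"
  using rdvd_same_degree_monic_eq[of "sk_lin b" "sk_lin c"] by auto

lemma monic_degree_1: "lead_coeff p = 1 \<Longrightarrow> degree p = 1 \<Longrightarrow> \<exists>c. p = sk_lin c"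
  by (rule exI[of _ "- coeff p 0"], rule poly_eqI)
    (auto simp: sk_lin_def coeff_pCons coeff_eq_0 split: nat.split)

lemma degree_1_associated_sk_lin:
  assumes "degree p = 1"
  shows "\<exists>c. sk_lin c rdvd p"
proof -
  define c where "c = lead_coeff p"
  have c: "c \<noteq> 0"
    using assms unfolding c_def by (metis degree_0 leading_coeff_0_iff zero_neq_one)
  define q where "q = [:inverse c:] \<odot> p"
  have "lead_coeff q = 1"
    unfolding q_def lead_coeff_skew_times using c by (simp add: c_def[symmetric])
  moreover have "degree q = 1" using assms c by (simp add: q_def)
  moreover have "p = [:c:] \<odot> q" using c by (simp add: q_def scal_scal)
  ultimately show ?thesis by (metis monic_degree_1 rdvd_times)
qed

text \<open>\<open>e\<close> is the skew evaluation of \<open>G\<close> at \<open>b\<close>; it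
  vanishes exactly when \<open>sk_lin b\<close> right-divides \<open>G\<close>.\<close>

lemma sk_lin_remainder: obtains q e where "G = q \<odot> sk_lin b + [:e:]"
  using right_division[of "sk_lin b" G] that
  by (metis degree_eq_zeroE degree_sk_lin less_one pCons_0_0 sk_lin_neq_0)

lemma sk_conj_1 [simp]: "sk_conj \<sigma> \<delta> 1 b = b"
  by (simp add: sk_conj_def)

text \<open>Conjugation is a left action of the nonzero elements, and the classes are its
  orbits.\<close>

lemma sk_conj_sk_conj:
  assumes "c \<noteq> 0" "d \<noteq> 0"
  shows "sk_conj \<sigma> \<delta> c (sk_conj \<sigma> \<delta> d b) = sk_conj \<sigma> \<delta> (c * d) b"
proof -
  have "d * (inverse d * inverse c) = inverse c"
    using assms by (simp add: mult.assoc[symmetric])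
  then show ?thesis
    using assms by (simp add: sk_conj_def sigma_mult delta_mult nonzero_inverse_mult_distrib
        distrib_left distrib_right mult.assoc add.assoc)
qed

lemma sk_conj_inverse: "c \<noteq> 0 \<Longrightarrow> sk_conj \<sigma> \<delta> (inverse c) (sk_conj \<sigma> \<delta> c b) = b"
  by (simp add: sk_conj_sk_conj)

lemma self_in_sk_C: "a \<in> sk_C \<sigma> \<delta> a"
  unfolding sk_C_def using sk_conj_1 by (metis (mono_tags, lifting) mem_Collect_eq zero_neq_one)

lemma sk_conj_in_sk_C_iff:
  assumes "c \<noteq> 0"
  shows "sk_conj \<sigma> \<delta> c b \<in> sk_C \<sigma> \<delta> a \<longleftrightarrow> b \<in> sk_C \<sigma> \<delta> a"
proof
  assume "b \<in> sk_C \<sigma> \<delta> a"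
  then obtain \<beta> where "\<beta> \<noteq> 0" "b = sk_conj \<sigma> \<delta> \<beta> a" unfolding sk_C_def by blast
  then have "sk_conj \<sigma> \<delta> c b = sk_conj \<sigma> \<delta> (c * \<beta>) a" "c * \<beta> \<noteq> 0"
    using assms by (simp_all add: sk_conj_sk_conj)
  then show "sk_conj \<sigma> \<delta> c b \<in> sk_C \<sigma> \<delta> a" unfolding sk_C_def by blast
next
  assume "sk_conj \<sigma> \<delta> c b \<in> sk_C \<sigma> \<delta> a"
  then obtain \<beta> where "\<beta> \<noteq> 0" "sk_conj \<sigma> \<delta> c b = sk_conj \<sigma> \<delta> \<beta> a" unfolding sk_C_def by blast
  then have "b = sk_conj \<sigma> \<delta> (inverse c * \<beta>) a" "inverse c * \<beta> \<noteq> 0"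
    using assms sk_conj_inverse[OF assms, of b] by (simp_all add: sk_conj_sk_conj)
  then show "b \<in> sk_C \<sigma> \<delta> a" unfolding sk_C_def by blast
qed

lemma sk_C_eq: "b \<in> sk_C \<sigma> \<delta> a \<Longrightarrow> sk_C \<sigma> \<delta> b = sk_C \<sigma> \<delta> a"
proof -
  assume b: "b \<in> sk_C \<sigma> \<delta> a"
  then obtain \<beta> where \<beta>: "\<beta> \<noteq> 0" "b = sk_conj \<sigma> \<delta> \<beta> a" unfolding sk_C_def by blast
  have "a \<in> sk_C \<sigma> \<delta> b"
    using sk_conj_in_sk_C_iff[of "\<beta>" a b] \<beta> self_in_sk_C[of b] by simp
  then show ?thesis
    using b sk_conj_in_sk_C_iff unfolding sk_C_def by blast
qed

text \<open>The origin of conjugation: pushing a linear factor past a constant conjugates its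
  root.\<close>

lemma sk_lin_conj_times_const:
  assumes "c \<noteq> 0"
  shows "sk_lin (sk_conj \<sigma> \<delta> c b) \<odot> [:c:] = [:\<sigma> c:] \<odot> sk_lin b"
proof -
  have "xmul [:c:] = [:\<delta> c, \<sigma> c:]"
    by (rule poly_eqI) (auto simp: coeff_xmul coeff_pCons split: nat.split)
  then show ?thesis
    using assms by (simp add: sk_lin_def sk_conj_def distrib_right left_diff_distrib mult.assoc)
qed

lemma sk_lin_rdvd_times_const_iff:
  assumes "c \<noteq> 0"
  shows "sk_lin b rdvd f \<odot> [:c:] \<longleftrightarrow> sk_lin (sk_conj \<sigma> \<delta> c b) rdvd f"
proof -
  \<comment> \<open>Stated for arbitrary \<open>b\<close>, \<open>c\<close> and \<open>f\<close>,
    since the converse applies it to \<open>inverse c\<close>.\<close>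
  have *: "sk_lin b rdvd f \<odot> [:c:]" if "sk_lin (sk_conj \<sigma> \<delta> c b) rdvd f" "c \<noteq> 0" for b c f
  proof -
    obtain g where "f = g \<odot> sk_lin (sk_conj \<sigma> \<delta> c b)" using \<open>_ rdvd f\<close> unfolding sk_rdvd_def by blast
    then have "f \<odot> [:c:] = g \<odot> ([:\<sigma> c:] \<odot> sk_lin b)"
      using sk_lin_conj_times_const[OF that(2), of b] by (metis skew_times_assoc)
    then show ?thesis by (metis rdvd_times_left rdvd_times)
  qed
  have "sk_lin (sk_conj \<sigma> \<delta> c b) rdvd f" if "sk_lin b rdvd f \<odot> [:c:]"
  proof -
    have "[:c:] \<odot> [:inverse c:] = [:1:]" using assms by simp
    then have "f = f \<odot> [:c:] \<odot> [:inverse c:]" by (metis skew_times_assoc skew_times_1_right)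
    moreover have "sk_lin (sk_conj \<sigma> \<delta> c b) rdvd f \<odot> [:c:] \<odot> [:inverse c:]"
      by (rule *) (use assms that in \<open>simp_all add: sk_conj_inverse\<close>)
    ultimately show ?thesis by metis
  qed
  with * assms show ?thesis by blast
qed

text \<open>Product rule: if \<open>e\<close> is the nonzero value of \<open>g\<close> at
  \<open>b\<close>, then \<open>f \<odot> g\<close> has at \<open>b\<close> the value of
  \<open>f\<close> at \<open>sk_conj \<sigma> \<delta> e b\<close>, times \<open>e\<close>.\<close>

lemma sk_lin_rdvd_times_cases:
  assumes "sk_lin b rdvd f \<odot> g"
  shows "sk_lin b rdvd g \<or> (\<exists>e. e \<noteq> 0 \<and> sk_lin (sk_conj \<sigma> \<delta> e b) rdvd f)"
proof -
  obtain q e where g: "g = q \<odot> sk_lin b + [:e:]" by (rule sk_lin_remainder)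
  show ?thesis
  proof (cases "e = 0")
    case False
    have "f \<odot> [:e:] = f \<odot> g - f \<odot> q \<odot> sk_lin b"
      by (simp add: g skew_times_add_right skew_times_assoc)
    then have "sk_lin b rdvd f \<odot> [:e:]" using assms by (metis rdvd_diff rdvd_times)
    with False sk_lin_rdvd_times_const_iff show ?thesis by blast
  qed (simp add: g)
qed

text \<open>The conjugate at which the product rule evaluates \<open>f\<close> stays in the class,
  where \<open>f\<close> vanishes.\<close>

lemma sk_lin_rdvd_times_class:
  assumes "\<And>b. b \<in> sk_C \<sigma> \<delta> a \<Longrightarrow> sk_lin b rdvd f" "b \<in> sk_C \<sigma> \<delta> a"
  shows "sk_lin b rdvd f \<odot> g"
proof -
  obtain q e where g: "g = q \<odot> sk_lin b + [:e:]" by (rule sk_lin_remainder)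
  have "sk_lin b rdvd f \<odot> [:e:]"
    using assms sk_conj_in_sk_C_iff by (cases "e = 0") (simp_all add: sk_lin_rdvd_times_const_iff)
  then show ?thesis
    by (simp add: g skew_times_add_right skew_times_assoc rdvd_add)
qed

subsection \<open>Products of linear factors\<close>

lemma sk_Pseq_Nil [simp]: "sk_Pseq \<sigma> \<delta> [] = [:1:]"
  by (simp add: sk_Pseq_def)

lemma sk_Pseq_snoc [simp]: "sk_Pseq \<sigma> \<delta> (bs @ [b]) = sk_lin b \<odot> sk_Pseq \<sigma> \<delta> bs"
  by (simp add: sk_Pseq_def)

lemma sk_Pseq_singleton [simp]: "sk_Pseq \<sigma> \<delta> [b] = sk_lin b"
  using sk_Pseq_snoc[of "[]" b] by simp

lemma sk_Pseq_append: "sk_Pseq \<sigma> \<delta> (bs @ cs) = sk_Pseq \<sigma> \<delta> cs \<odot> sk_Pseq \<sigma> \<delta> bs"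
proof (induction cs rule: rev_induct)
  case (snoc c cs)
  have "sk_Pseq \<sigma> \<delta> (bs @ cs @ [c]) = sk_lin c \<odot> sk_Pseq \<sigma> \<delta> (bs @ cs)"
    using sk_Pseq_snoc[of "bs @ cs" c] by simp
  with snoc show ?case by (simp add: skew_times_assoc)
qed simp

lemma lead_coeff_sk_Pseq: "lead_coeff (sk_Pseq \<sigma> \<delta> bs) = 1"
  by (induction bs rule: rev_induct) (simp_all add: lead_coeff_skew_times)

lemma sk_Pseq_neq_0 [simp]: "sk_Pseq \<sigma> \<delta> bs \<noteq> 0"
  using lead_coeff_sk_Pseq[of bs] by auto

lemma degree_sk_Pseq [simp]: "degree (sk_Pseq \<sigma> \<delta> bs) = length bs"
  by (induction bs rule: rev_induct) (simp_all add: degree_skew_times)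

text \<open>Let \<open>G\<close> be the product for all entries but the last. If \<open>D\<close> is
  coprime to \<open>G\<close>, their lclm has degree \<open>degree D + degree G\<close> and
  right-divides a polynomial of degree \<open>1 + degree G\<close>, so \<open>D\<close> is linear.
  Otherwise \<open>D\<close> and \<open>G\<close> share a nonconstant right divisor, to which
  induction applies.\<close>

lemma rdvd_sk_Pseq_has_sk_lin:
  assumes "D rdvd sk_Pseq \<sigma> \<delta> bs" "degree D \<noteq> 0"
  shows "\<exists>d. sk_lin d rdvd D"
  using assms
proof (induction bs arbitrary: D rule: rev_induct)
  case Nil
  then show ?case using rdvd_imp_degree_le[of D "[:1:]"] by simp
next
  case (snoc b bs)
  let ?G = "sk_Pseq \<sigma> \<delta> bs"
  have D0: "D \<noteq> 0" using snoc.prems by auto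
  show ?case
  proof (cases "coprime_right D ?G")
    case True
    then obtain L where L: "\<And>F. D rdvd F \<Longrightarrow> ?G rdvd F \<Longrightarrow> L rdvd F" "L \<noteq> 0"
      and deg: "degree L = degree D + degree ?G"
      using coprime_right_lclm[OF D0 sk_Pseq_neq_0 True] by blast
    have "L rdvd sk_lin b \<odot> ?G" using snoc.prems(1) by (intro L) simp_all
    then have "degree L \<le> 1 + degree ?G"
      using rdvd_imp_degree_le[of L "sk_lin b \<odot> ?G"] by (simp add: degree_skew_times)
    then have "degree D = 1" using deg snoc.prems(2) by simp
    then show ?thesis by (rule degree_1_associated_sk_lin)
  next
    case False
    then obtain E where E: "E rdvd D" "E rdvd ?G" "degree E \<noteq> 0"
      using coprime_rightI[OF D0 sk_Pseq_neq_0, of bs] by blast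
    then show ?thesis using snoc.IH[OF E(2,3)] rdvd_trans by blast
  qed
qed

lemma sk_lin_rdvd_sk_Pseq_class:
  assumes "set bs \<subseteq> sk_C \<sigma> \<delta> a" "sk_lin b rdvd sk_Pseq \<sigma> \<delta> bs"
  shows "b \<in> sk_C \<sigma> \<delta> a"
  using assms
proof (induction bs rule: rev_induct)
  case Nil
  then show ?case using rdvd_imp_degree_le[of "sk_lin b" "[:1:]"] by simp
next
  case (snoc c bs)
  from snoc.prems(2) sk_lin_rdvd_times_cases[of b "sk_lin c" "sk_Pseq \<sigma> \<delta> bs"]
  consider "sk_lin b rdvd sk_Pseq \<sigma> \<delta> bs" | e where "e \<noteq> 0" "sk_conj \<sigma> \<delta> e b = c"
    by auto
  then show ?case
  proof cases
    case 2
    then show ?thesis using snoc.prems(1) sk_conj_in_sk_C_iff by auto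
  qed (use snoc in auto)
qed

text \<open>A nonconstant common right divisor would right-divide a product of linear factors and so
  have a root, common to \<open>A\<close> and \<open>B\<close>.\<close>

lemma coprime_right_sk_PseqI:
  assumes "A rdvd sk_Pseq \<sigma> \<delta> bs" "A \<noteq> 0" "B \<noteq> 0" "\<And>d. sk_lin d rdvd A \<Longrightarrow> sk_lin d rdvd B \<Longrightarrow> False"
  shows "coprime_right A B"
proof (rule coprime_rightI[OF assms(2,3)], rule ccontr)
  fix D assume D: "D rdvd A" "D rdvd B" "degree D \<noteq> 0"
  then obtain d where "sk_lin d rdvd D"
    using rdvd_sk_Pseq_has_sk_lin[OF rdvd_trans[OF D(1) assms(1)]] by blast
  then show False using assms(4) D rdvd_trans by blast
qed

lemma coprime_right_sk_lin_iff:
  assumes "A \<noteq> 0"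
  shows "coprime_right A (sk_lin b) \<longleftrightarrow> \<not> sk_lin b rdvd A"
proof
  show "\<not> sk_lin b rdvd A" if "coprime_right A (sk_lin b)"
    using coprime_right_common_divisor[OF that, of "sk_lin b"] by auto
  show "coprime_right A (sk_lin b)" if n: "\<not> sk_lin b rdvd A"
  proof (rule coprime_rightI[OF assms sk_lin_neq_0], rule ccontr)
    fix D assume D: "D rdvd A" "D rdvd sk_lin b" "degree D \<noteq> 0"
    then have "sk_lin b rdvd D" using rdvd_same_degree[of D "sk_lin b"] by simp
    with D n rdvd_trans show False by blast
  qed
qed

text \<open>A Newton interpolation step: conjugating \<open>c\<close> by the value of
  \<open>W\<close> at \<open>c\<close> yields the factor that makes the product vanish at
  \<open>c\<close>. By degree this product is an lclm of \<open>W\<close> and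
  \<open>sk_lin c\<close>.\<close>

lemma lclm_sk_lin:
  assumes "W \<noteq> 0" "\<not> sk_lin c rdvd W"
  shows "\<exists>c'. c' \<in> sk_C \<sigma> \<delta> c \<and> sk_lin c rdvd sk_lin c' \<odot> W \<and>
    (\<forall>F. W rdvd F \<longrightarrow> sk_lin c rdvd F \<longrightarrow> sk_lin c' \<odot> W rdvd F)"
proof -
  obtain q e where W: "W = q \<odot> sk_lin c + [:e:]" by (rule sk_lin_remainder)
  with assms(2) have e: "e \<noteq> 0" by auto
  define c' where "c' = sk_conj \<sigma> \<delta> e c"
  have "sk_lin c rdvd sk_lin c' \<odot> [:e:]"
    unfolding sk_lin_rdvd_times_const_iff[OF e] by (simp add: c'_def)
  then have dvd: "sk_lin c rdvd sk_lin c' \<odot> W"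
    by (simp add: W skew_times_add_right skew_times_assoc rdvd_add)
  have "coprime_right W (sk_lin c)"
    using assms by (simp add: coprime_right_sk_lin_iff)
  from coprime_right_lclm[OF assms(1) sk_lin_neq_0 this]
  obtain L where L: "\<And>F. W rdvd F \<Longrightarrow> sk_lin c rdvd F \<Longrightarrow> L rdvd F" "L \<noteq> 0"
    and deg: "degree L = degree W + degree (sk_lin c)" by blast
  have "L rdvd sk_lin c' \<odot> W" using dvd by (simp add: L)
  then have "sk_lin c' \<odot> W rdvd L"
    by (rule rdvd_same_degree) (use assms(1) deg in \<open>simp_all add: degree_skew_times\<close>)
  then have "sk_lin c' \<odot> W rdvd F" if "W rdvd F" "sk_lin c rdvd F" for F
    using L(1)[OF that] rdvd_trans by blast
  moreover have "c' \<in> sk_C \<sigma> \<delta> c"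
    using e self_in_sk_C by (simp add: c'_def sk_conj_in_sk_C_iff)
  ultimately show ?thesis using dvd by blast
qed

section \<open>Powers, and least common left multiples of finite families\<close>

lemma sk_pow_0 [simp]: "sk_pow \<sigma> \<delta> p 0 = [:1:]"
  and sk_pow_Suc [simp]: "sk_pow \<sigma> \<delta> p (Suc n) = p \<odot> sk_pow \<sigma> \<delta> p n"
  by (simp_all add: sk_pow_def)

lemma lead_coeff_sk_pow: "lead_coeff p = 1 \<Longrightarrow> lead_coeff (sk_pow \<sigma> \<delta> p n) = 1"
  by (induction n) (simp_all add: lead_coeff_skew_times)

lemma degree_sk_pow: "p \<noteq> 0 \<Longrightarrow> sk_pow \<sigma> \<delta> p n \<noteq> 0 \<and> degree (sk_pow \<sigma> \<delta> p n) = n * degree p"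
  by (induction n) (auto simp: degree_skew_times)

lemma sk_pow_sk_Pseq: "\<exists>cs. set cs \<subseteq> set bs \<and> sk_pow \<sigma> \<delta> (sk_Pseq \<sigma> \<delta> bs) n = sk_Pseq \<sigma> \<delta> cs"
proof (induction n)
  case 0
  show ?case by (rule exI[of _ "[]"]) simp
next
  case (Suc n)
  then obtain cs where "set cs \<subseteq> set bs" "sk_pow \<sigma> \<delta> (sk_Pseq \<sigma> \<delta> bs) n = sk_Pseq \<sigma> \<delta> cs" by blast
  then show ?case by (intro exI[of _ "cs @ bs"]) (simp add: sk_Pseq_append)
qed

lemma finite_imp_sk_algebraic:
  assumes "finite \<Omega>" "0 \<notin> \<Omega>"
  shows "sk_algebraic \<sigma> \<delta> \<Omega>"
  using assms
proof (induction \<Omega> rule: finite_induct)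
  case empty
  show ?case unfolding sk_algebraic_iff by (rule exI[of _ "[:1:]"]) simp
next
  case (insert A \<Omega>)
  then obtain F where F: "F \<noteq> 0" "\<forall>Q\<in>\<Omega>. Q rdvd F" by (auto simp: sk_algebraic_iff)
  have "A \<noteq> 0" using insert.prems by auto
  then obtain L where "L \<noteq> 0" "F rdvd L" "A rdvd L" using gcrd_lclm[OF F(1)] by blast
  with F(2) show ?case unfolding sk_algebraic_iff by (intro exI[of _ L]) (auto intro: rdvd_trans)
qed

lemma sk_min_empty [simp]: "sk_min \<sigma> \<delta> {} = [:1:]"
  by (rule sk_min_eqI) (simp_all add: rdvd_const)

lemma degree_sk_min_insert_le:
  assumes "sk_algebraic \<sigma> \<delta> \<Omega>" "A \<noteq> 0"
  shows "degree (sk_min \<sigma> \<delta> (insert A \<Omega>)) \<le> degree (sk_min \<sigma> \<delta> \<Omega>) + degree A"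
proof -
  have min0: "sk_min \<sigma> \<delta> \<Omega> \<noteq> 0" using lead_coeff_sk_min[OF assms(1)] by auto
  obtain D L :: "'a poly" where L: "L \<noteq> 0" "sk_min \<sigma> \<delta> \<Omega> rdvd L" "A rdvd L"
    and deg: "degree D + degree L = degree (sk_min \<sigma> \<delta> \<Omega>) + degree A"
    using gcrd_lclm[OF min0 assms(2)] by blast
  have dvd: "Q rdvd L" if "Q \<in> insert A \<Omega>" for Q
    using that L rdvd_trans[OF rdvd_sk_min[OF assms(1)] L(2)] by blast
  then have "sk_algebraic \<sigma> \<delta> (insert A \<Omega>)" unfolding sk_algebraic_iff using L(1) by blast
  then have "sk_min \<sigma> \<delta> (insert A \<Omega>) rdvd L" using dvd by (rule sk_min_rdvd)
  then have "degree (sk_min \<sigma> \<delta> (insert A \<Omega>)) \<le> degree L" using L(1) by (rule rdvd_imp_degree_le)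
  with deg show ?thesis by simp
qed

lemma degree_sk_min_insert_coprime:
  assumes "sk_algebraic \<sigma> \<delta> (insert A \<Omega>)" "A \<noteq> 0" "coprime_right (sk_min \<sigma> \<delta> \<Omega>) A"
  shows "degree (sk_min \<sigma> \<delta> (insert A \<Omega>)) = degree (sk_min \<sigma> \<delta> \<Omega>) + degree A"
proof (rule antisym)
  have alg: "sk_algebraic \<sigma> \<delta> \<Omega>" using assms(1) by (auto simp: sk_algebraic_iff)
  then show "degree (sk_min \<sigma> \<delta> (insert A \<Omega>)) \<le> degree (sk_min \<sigma> \<delta> \<Omega>) + degree A"
    using assms(2) by (rule degree_sk_min_insert_le)
  have min0: "sk_min \<sigma> \<delta> \<Omega> \<noteq> 0" "sk_min \<sigma> \<delta> (insert A \<Omega>) \<noteq> 0"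
    using lead_coeff_sk_min[OF alg] lead_coeff_sk_min[OF assms(1)] by auto
  obtain L where L: "\<And>F. sk_min \<sigma> \<delta> \<Omega> rdvd F \<Longrightarrow> A rdvd F \<Longrightarrow> L rdvd F"
    and deg: "degree L = degree (sk_min \<sigma> \<delta> \<Omega>) + degree A"
    using coprime_right_lclm[OF min0(1) assms(2,3)] by blast
  have "L rdvd sk_min \<sigma> \<delta> (insert A \<Omega>)"
    using alg assms(1) by (intro L sk_min_rdvd rdvd_sk_min) auto
  then show "degree (sk_min \<sigma> \<delta> \<Omega>) + degree A \<le> degree (sk_min \<sigma> \<delta> (insert A \<Omega>))"
    using rdvd_imp_degree_le[OF _ min0(2)] deg by metis
qed

lemma sk_algebraic_sk_lin_finite: "finite B \<Longrightarrow> sk_algebraic \<sigma> \<delta> (sk_lin ` B)"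
  by (rule finite_imp_sk_algebraic) (auto simp: sk_lin_def)

lemma lead_coeff_sk_minS: "finite B \<Longrightarrow> lead_coeff (sk_minS \<sigma> \<delta> B) = 1"
  unfolding sk_minS_def by (intro lead_coeff_sk_min sk_algebraic_sk_lin_finite)

lemma sk_minS_rdvd: "finite B \<Longrightarrow> (\<And>b. b \<in> B \<Longrightarrow> sk_lin b rdvd F) \<Longrightarrow> sk_minS \<sigma> \<delta> B rdvd F"
  unfolding sk_minS_def using sk_min_rdvd[OF sk_algebraic_sk_lin_finite] by blast

lemma sk_lin_rdvd_sk_minS: "finite B \<Longrightarrow> b \<in> B \<Longrightarrow> sk_lin b rdvd sk_minS \<sigma> \<delta> B"
  unfolding sk_minS_def using rdvd_sk_min[OF sk_algebraic_sk_lin_finite] by blast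

lemma degree_sk_minS_le: "finite B \<Longrightarrow> degree (sk_minS \<sigma> \<delta> B) \<le> card B"
proof (induction B rule: finite_induct)
  case (insert b B)
  then show ?case
    using degree_sk_min_insert_le[OF sk_algebraic_sk_lin_finite[OF insert(1)], of "sk_lin b"]
    by (simp add: sk_minS_def)
qed (simp add: sk_minS_def)

lemma degree_sk_minS_insert:
  assumes "finite B" "\<not> sk_lin c rdvd sk_minS \<sigma> \<delta> B"
  shows "degree (sk_minS \<sigma> \<delta> (insert c B)) = Suc (degree (sk_minS \<sigma> \<delta> B))"
proof -
  have "sk_minS \<sigma> \<delta> B \<noteq> 0" using lead_coeff_sk_minS[OF assms(1)] by auto
  then have "coprime_right (sk_min \<sigma> \<delta> (sk_lin ` B)) (sk_lin c)"
    using assms(2) by (simp add: coprime_right_sk_lin_iff sk_minS_def)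
  from degree_sk_min_insert_coprime[OF _ _ this] show ?thesis
    using sk_algebraic_sk_lin_finite[of "insert c B"] assms(1) by (simp add: sk_minS_def)
qed

text \<open>Each root raises the degree of the minimal polynomial by at most one, so full degree for
  \<open>insert c B\<close> leaves no slack at \<open>B\<close>.\<close>

lemma sk_minS_independent_insertD:
  assumes "finite B" "c \<notin> B" "degree (sk_minS \<sigma> \<delta> (insert c B)) = card (insert c B)"
  shows "degree (sk_minS \<sigma> \<delta> B) = card B" "\<not> sk_lin c rdvd sk_minS \<sigma> \<delta> B"
proof -
  show dvd: "\<not> sk_lin c rdvd sk_minS \<sigma> \<delta> B"
  proof
    assume "sk_lin c rdvd sk_minS \<sigma> \<delta> B"
    then have "sk_minS \<sigma> \<delta> (insert c B) rdvd sk_minS \<sigma> \<delta> B"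
      using assms(1) by (intro sk_minS_rdvd) (auto intro: sk_lin_rdvd_sk_minS)
    moreover have "sk_minS \<sigma> \<delta> B \<noteq> 0" using lead_coeff_sk_minS[OF assms(1)] by auto
    ultimately have "degree (sk_minS \<sigma> \<delta> (insert c B)) \<le> degree (sk_minS \<sigma> \<delta> B)"
      by (rule rdvd_imp_degree_le)
    then show False using assms degree_sk_minS_le[OF assms(1)] by simp
  qed
  show "degree (sk_minS \<sigma> \<delta> B) = card B"
    using degree_sk_minS_insert[OF assms(1) dvd] assms by simp
qed

text \<open>A modular law: the left ideals \<open>I = RP\<close>, \<open>J = RU\<close>, \<open>K = RV\<close> satisfy
  \<open>(I + J) \<inter> (I + K) \<subseteq> I + (J \<inter> K)\<close> if \<open>I\<close> is two-sided and \<open>J + K = R\<close>.\<close>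

lemma two_sided_modular:
  assumes P: "\<And>g. P rdvd P \<odot> g" and UV: "coprime_right U V"
    and z: "z = p1 \<odot> P + u \<odot> U" "z = p2 \<odot> P + v \<odot> V"
  shows "\<exists>p w. z = p \<odot> P + w \<and> U rdvd w \<and> V rdvd w"
proof -
  obtain \<alpha> \<beta> where ab: "\<alpha> \<odot> U + \<beta> \<odot> V = [:1:]" using UV unfolding coprime_right_def by blast
  \<comment> \<open>\<open>d\<close> is the difference \<open>u \<odot> U - v \<odot> V\<close> of
    the two representations. The Bezout identity splits it into a multiple of \<open>U\<close> and
    one of \<open>V\<close>; the former is also a left multiple of \<open>P\<close> and is moved
    into the \<open>P\<close> term.\<close>
  define d where "d = (p2 - p1) \<odot> P"
  have "d = d \<odot> (\<alpha> \<odot> U + \<beta> \<odot> V)" by (simp only: ab skew_times_1_right)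
  then have d: "d = d \<odot> \<alpha> \<odot> U + d \<odot> \<beta> \<odot> V" by (simp only: skew_times_add_right skew_times_assoc)
  define w where "w = u \<odot> U - d \<odot> \<alpha> \<odot> U"
  have "u \<odot> U = d + v \<odot> V"
    using z unfolding d_def skew_times_diff_left by (simp add: algebra_simps)
  then have "w = (d - d \<odot> \<alpha> \<odot> U) + v \<odot> V" by (simp add: w_def)
  also have "d - d \<odot> \<alpha> \<odot> U = d \<odot> \<beta> \<odot> V" using d by (metis add_diff_cancel_left')
  finally have w: "w = d \<odot> \<beta> \<odot> V + v \<odot> V" .
  have "P rdvd d \<odot> \<alpha> \<odot> U"
    using P[of "\<alpha> \<odot> U"] by (simp add: d_def skew_times_assoc[symmetric] rdvd_times_left)
  then have "P rdvd p1 \<odot> P + d \<odot> \<alpha> \<odot> U" by (simp add: rdvd_add)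
  then obtain p where p: "p1 \<odot> P + d \<odot> \<alpha> \<odot> U = p \<odot> P" unfolding sk_rdvd_def by blast
  have "z = (p1 \<odot> P + d \<odot> \<alpha> \<odot> U) + w" unfolding w_def z(1) by simp
  then have "z = p \<odot> P + w" by (simp only: p)
  moreover have "U rdvd w" unfolding w_def by (simp add: rdvd_diff)
  moreover have "V rdvd w" unfolding w by (simp add: rdvd_add)
  ultimately show ?thesis by blast
qed

end

locale algebraic_skew_poly = skew_poly +
  assumes algebraic_class: "sk_algebraic \<sigma> \<delta> (sk_lin ` sk_C \<sigma> \<delta> c)"
begin

abbreviation class_poly :: "'a \<Rightarrow> 'a poly"
  where "class_poly a \<equiv> sk_minS \<sigma> \<delta> (sk_C \<sigma> \<delta> a)"

abbreviation class_pow :: "'a \<Rightarrow> nat \<Rightarrow> 'a poly"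
  where "class_pow a n \<equiv> sk_pow \<sigma> \<delta> (class_poly a) n"

subsection \<open>The minimal polynomial of a conjugacy class\<close>

lemma lead_coeff_class_poly: "lead_coeff (class_poly a) = 1"
  using lead_coeff_sk_min[OF algebraic_class] by (simp add: sk_minS_def)

lemma class_poly_neq_0 [simp]: "class_poly a \<noteq> 0"
  using lead_coeff_class_poly[of a] by auto

lemma sk_lin_rdvd_class_poly: "b \<in> sk_C \<sigma> \<delta> a \<Longrightarrow> sk_lin b rdvd class_poly a"
  using rdvd_sk_min[OF algebraic_class] by (simp add: sk_minS_def)

lemma class_poly_rdvd: "(\<And>b. b \<in> sk_C \<sigma> \<delta> a \<Longrightarrow> sk_lin b rdvd F) \<Longrightarrow> class_poly a rdvd F"
  unfolding sk_minS_def using sk_min_rdvd[OF algebraic_class] by blast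

text \<open>Roots in the class decide divisibility by \<open>class_poly a\<close>, and the product
  rule preserves them: the left ideal is two-sided.\<close>

lemma class_poly_rdvd_times:
  assumes "class_poly a rdvd F"
  shows "class_poly a rdvd F \<odot> g"
proof (rule class_poly_rdvd)
  fix b assume "b \<in> sk_C \<sigma> \<delta> a"
  with assms show "sk_lin b rdvd F \<odot> g"
    using sk_lin_rdvd_times_class[of a F] rdvd_trans[OF sk_lin_rdvd_class_poly] by blast
qed

lemma class_pow_neq_0 [simp]: "class_pow a n \<noteq> 0"
  and degree_class_pow: "degree (class_pow a n) = n * degree (class_poly a)"
  by (simp_all add: degree_sk_pow)

text \<open>\<open>g\<close> is carried to the left past \<open>class_pow a n\<close> by induction,
  and then past one more \<open>class_poly a\<close> by two-sidedness.\<close>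

lemma class_pow_rdvd_times: "class_pow a n rdvd class_pow a n \<odot> g"
proof (induction n arbitrary: g)
  case (Suc n)
  obtain h where h: "class_pow a n \<odot> g = h \<odot> class_pow a n"
    using Suc unfolding sk_rdvd_def by blast
  have "class_pow a (Suc n) \<odot> g = class_poly a \<odot> h \<odot> class_pow a n"
    by (metis h skew_times_assoc sk_pow_Suc)
  moreover have "class_poly a rdvd class_poly a \<odot> h" by (simp add: class_poly_rdvd_times)
  ultimately show ?case by (simp add: rdvd_imp_times_rdvd_times)
qed (simp add: rdvd_const del: skew_times_pCons)

text \<open>A longest product of linear factors with roots in the class that right-divides
  \<open>class_poly a\<close> has every class element as a root, since a missing one would prolong
  it by \<open>lclm_sk_lin\<close>.\<close>

lemma class_poly_eq_sk_Pseq: "\<exists>bs. set bs \<subseteq> sk_C \<sigma> \<delta> a \<and> class_poly a = sk_Pseq \<sigma> \<delta> bs"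
proof -
  let ?Q = "\<lambda>bs. set bs \<subseteq> sk_C \<sigma> \<delta> a \<and> sk_Pseq \<sigma> \<delta> bs rdvd class_poly a"
  have "?Q []" by (simp add: rdvd_const)
  moreover have "\<forall>bs. ?Q bs \<longrightarrow> length bs < Suc (degree (class_poly a))"
    using rdvd_imp_degree_le[OF _ class_poly_neq_0] by fastforce
  ultimately have "\<exists>bs. ?Q bs \<and> (\<forall>cs. ?Q cs \<longrightarrow> length cs \<le> length bs)"
    by (rule ex_has_greatest_nat)
  then obtain bs where "?Q bs \<and> (\<forall>cs. ?Q cs \<longrightarrow> length cs \<le> length bs)" by (rule exE)
  then have bs: "?Q bs" and bs_max: "\<And>cs. ?Q cs \<Longrightarrow> length cs \<le> length bs" by simp_all
  have "class_poly a rdvd sk_Pseq \<sigma> \<delta> bs"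
  proof (rule class_poly_rdvd, rule ccontr)
    fix c assume c: "c \<in> sk_C \<sigma> \<delta> a" "\<not> sk_lin c rdvd sk_Pseq \<sigma> \<delta> bs"
    obtain c' where c': "c' \<in> sk_C \<sigma> \<delta> c" "sk_lin c rdvd sk_lin c' \<odot> sk_Pseq \<sigma> \<delta> bs"
      "\<And>F. sk_Pseq \<sigma> \<delta> bs rdvd F \<Longrightarrow> sk_lin c rdvd F \<Longrightarrow> sk_lin c' \<odot> sk_Pseq \<sigma> \<delta> bs rdvd F"
      using lclm_sk_lin[OF sk_Pseq_neq_0 c(2)] by blast
    have "?Q (bs @ [c'])"
      using bs c(1) c'(1) sk_C_eq[OF c(1)] c'(3)[of "class_poly a"] sk_lin_rdvd_class_poly by simp
    with bs_max[of "bs @ [c']"] show False by simp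
  qed
  then have "sk_Pseq \<sigma> \<delta> bs = class_poly a"
    using bs rdvd_imp_degree_le[of "class_poly a" "sk_Pseq \<sigma> \<delta> bs"]
    by (intro rdvd_same_degree_monic_eq lead_coeff_sk_Pseq lead_coeff_class_poly) auto
  with bs show ?thesis by auto
qed

lemma class_pow_eq_sk_Pseq: "\<exists>bs. set bs \<subseteq> sk_C \<sigma> \<delta> a \<and> class_pow a n = sk_Pseq \<sigma> \<delta> bs"
  by (metis class_poly_eq_sk_Pseq sk_pow_sk_Pseq subset_trans)

lemma sk_lin_rdvd_class_pow: "sk_lin b rdvd class_pow a n \<Longrightarrow> b \<in> sk_C \<sigma> \<delta> a"
  by (metis class_pow_eq_sk_Pseq sk_lin_rdvd_sk_Pseq_class)

lemma sk_lin_rdvd_class_poly_iff: "sk_lin b rdvd class_poly a \<longleftrightarrow> b \<in> sk_C \<sigma> \<delta> a"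
  using sk_lin_rdvd_class_pow[of b a 1] sk_lin_rdvd_class_poly by auto

text \<open>Each new linear factor is absorbed by one more copy of \<open>class_poly a\<close>. That
  copy stands to the left of the cofactor \<open>h\<close>, and two-sidedness brings it to the
  right.\<close>

lemma sk_Pseq_rdvd_class_pow:
  assumes "set bs \<subseteq> sk_C \<sigma> \<delta> a"
  shows "sk_Pseq \<sigma> \<delta> bs rdvd class_pow a (length bs)"
  using assms
proof (induction bs rule: rev_induct)
  case (snoc b bs)
  then obtain h where h: "class_pow a (length bs) = h \<odot> sk_Pseq \<sigma> \<delta> bs"
    unfolding sk_rdvd_def by auto
  have "sk_lin b rdvd class_poly a" using snoc.prems by (simp add: sk_lin_rdvd_class_poly)
  also have "class_poly a rdvd class_poly a \<odot> h" by (simp add: class_poly_rdvd_times)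
  finally have "sk_lin b \<odot> sk_Pseq \<sigma> \<delta> bs rdvd class_poly a \<odot> h \<odot> sk_Pseq \<sigma> \<delta> bs"
    by (rule rdvd_imp_times_rdvd_times)
  then show ?case by (simp add: h skew_times_assoc)
qed simp

lemma coprime_class_poly:
  assumes "c \<notin> sk_C \<sigma> \<delta> a"
  shows "coprime_right (class_poly a) (class_poly c)"
proof -
  obtain bs where "class_poly a rdvd sk_Pseq \<sigma> \<delta> bs" using class_poly_eq_sk_Pseq rdvd_refl by metis
  moreover have False if "d \<in> sk_C \<sigma> \<delta> a" "d \<in> sk_C \<sigma> \<delta> c" for d
    using assms self_in_sk_C[of c] sk_C_eq[OF that(1)] sk_C_eq[OF that(2)] by simp
  ultimately show ?thesis
    by (intro coprime_right_sk_PseqI[of _ bs]) (auto simp: sk_lin_rdvd_class_poly_iff)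
qed

text \<open>Both products are monic common left multiples of degree \<open>degree P + degree Q\<close>, hence equal
  to the lclm of \<open>P\<close> and \<open>Q\<close>.\<close>

lemma class_poly_commute:
  assumes "c \<notin> sk_C \<sigma> \<delta> a"
  shows "class_poly a \<odot> class_poly c = class_poly c \<odot> class_poly a"
proof -
  let ?P = "class_poly a" and ?Q = "class_poly c"
  obtain L where L: "\<And>F. ?P rdvd F \<Longrightarrow> ?Q rdvd F \<Longrightarrow> L rdvd F" "L \<noteq> 0"
    "degree L = degree ?P + degree ?Q"
    using coprime_right_lclm[OF _ _ coprime_class_poly[OF assms]] by auto
  have "L rdvd ?P \<odot> ?Q" "L rdvd ?Q \<odot> ?P"
    using L(1) by (simp_all add: class_poly_rdvd_times)
  then have "?P \<odot> ?Q rdvd L"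
    using L(2,3) rdvd_same_degree[of L "?P \<odot> ?Q"] by (simp add: degree_skew_times)
  with \<open>L rdvd ?Q \<odot> ?P\<close> have "?P \<odot> ?Q rdvd ?Q \<odot> ?P" by (blast intro: rdvd_trans)
  then show ?thesis
    by (rule rdvd_same_degree_monic_eq)
      (simp_all only: lead_coeff_skew_times lead_coeff_class_poly, simp_all add: degree_skew_times)
qed

lemma class_pow_commute:
  assumes "c \<notin> sk_C \<sigma> \<delta> a"
  shows "class_pow a n \<odot> class_poly c = class_poly c \<odot> class_pow a n"
proof (induction n)
  case (Suc n)
  then show ?case using class_poly_commute[OF assms] by (metis sk_pow_Suc skew_times_assoc)
qed simp

subsection \<open>Multiplicity sequences\<close>

lemma sk_lin_hd_rdvd_sk_Pseq: "bs \<noteq> [] \<Longrightarrow> sk_lin (hd bs) rdvd sk_Pseq \<sigma> \<delta> bs"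
proof (induction bs rule: rev_induct)
  case (snoc b bs)
  then show ?case by (cases "bs = []") (auto simp: rdvd_times_left)
qed simp

lemma sk_mseq_iff:
  "sk_mseq \<sigma> \<delta> bs \<longleftrightarrow> bs \<noteq> [] \<and> (\<forall>b. sk_lin b rdvd sk_Pseq \<sigma> \<delta> bs \<longrightarrow> b = hd bs)"
  unfolding sk_mseq_def using sk_lin_hd_rdvd_sk_Pseq by auto

lemma sk_mseq_butlast: "sk_mseq \<sigma> \<delta> (bs @ [b]) \<Longrightarrow> bs \<noteq> [] \<Longrightarrow> sk_mseq \<sigma> \<delta> bs"
  unfolding sk_mseq_iff by (auto simp: rdvd_times_left)

lemma sk_mseq_singleton: "sk_mseq \<sigma> \<delta> [b]"
  by (simp add: sk_mseq_iff)

text \<open>Suppose the last entry \<open>c\<close> lies outside the class of the head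
  \<open>a\<close>. The only root \<open>a\<close> of the polynomial is no root of
  \<open>class_poly c\<close>, so the two are coprime. Hence \<open>class_poly c\<close> can be
  stripped from a multiple \<open>class_pow a n \<odot> class_poly c\<close>, and the polynomial
  right-divides \<open>class_pow a n\<close>. This forces \<open>c\<close> into the class of
  \<open>a\<close>.\<close>

lemma sk_mseq_same_class:
  assumes "sk_mseq \<sigma> \<delta> bs"
  shows "set bs \<subseteq> sk_C \<sigma> \<delta> (hd bs)"
  using assms
proof (induction bs rule: rev_induct)
  case (snoc c bs)
  show ?case
  proof (cases "bs = []")
    case True
    then show ?thesis by (simp add: self_in_sk_C)
  next
    case False
    define a where "a = hd bs"
    have bs: "set bs \<subseteq> sk_C \<sigma> \<delta> a" using snoc sk_mseq_butlast False by (simp add: a_def)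
    have "c \<in> sk_C \<sigma> \<delta> a"
    proof (rule ccontr)
      assume c: "c \<notin> sk_C \<sigma> \<delta> a"
      let ?A = "sk_Pseq \<sigma> \<delta> (bs @ [c])" and ?B = "sk_Pseq \<sigma> \<delta> bs"
      let ?Q = "class_poly c" and ?R = "class_pow a (length bs)"
      obtain h where h: "?R = h \<odot> ?B"
        using sk_Pseq_rdvd_class_pow[OF bs] unfolding sk_rdvd_def by blast
      obtain h' where h': "?Q \<odot> h = h' \<odot> ?Q"
        using class_poly_rdvd_times[OF rdvd_refl, of c h] unfolding sk_rdvd_def by blast
      have "?A rdvd ?Q \<odot> ?B"
        using sk_lin_rdvd_class_poly[OF self_in_sk_C] by (simp add: rdvd_imp_times_rdvd_times)
      \<comment> \<open>Commuting \<open>?Q\<close> past \<open>?R\<close> and then past the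
        cofactor \<open>h\<close> places it directly before \<open>?B\<close>.\<close>
      moreover have "?R \<odot> ?Q = h' \<odot> (?Q \<odot> ?B)"
        using class_pow_commute[OF c] h h' by (metis skew_times_assoc)
      ultimately have RQ: "?A rdvd ?R \<odot> ?Q" by (simp add: rdvd_times_left del: sk_Pseq_snoc)
      have "coprime_right ?A ?Q"
      proof (rule coprime_right_sk_PseqI[OF rdvd_refl])
        fix d assume "sk_lin d rdvd ?A" "sk_lin d rdvd ?Q"
        then have "d = a" "d \<in> sk_C \<sigma> \<delta> c"
          using snoc.prems False unfolding sk_mseq_iff by (auto simp: a_def sk_lin_rdvd_class_poly_iff)
        then show False using c sk_C_eq[of a c] self_in_sk_C[of c] by simp
      qed (simp_all del: sk_Pseq_snoc)
      then obtain u v where uv: "u \<odot> ?A + v \<odot> ?Q = [:1:]" unfolding coprime_right_def by blast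
      obtain v' where v': "?R \<odot> v = v' \<odot> ?R"
        using class_pow_rdvd_times unfolding sk_rdvd_def by blast
      have "?R = ?R \<odot> (u \<odot> ?A + v \<odot> ?Q)" by (simp only: uv skew_times_1_right)
      also have "\<dots> = ?R \<odot> u \<odot> ?A + v' \<odot> (?R \<odot> ?Q)"
        by (simp only: skew_times_add_right skew_times_assoc v')
      finally have "?A rdvd ?R" using RQ by (metis rdvd_add rdvd_times rdvd_times_left)
      \<comment> \<open>Two-sidedness allows \<open>?B\<close> to be appended on the right, where it
        cancels against the \<open>?B\<close> inside \<open>?A\<close>.\<close>
      also have "?R rdvd ?R \<odot> ?B" by (rule class_pow_rdvd_times)
      finally have "sk_lin c rdvd ?R" by (simp add: rdvd_times_cancel)
      then show False using c sk_lin_rdvd_class_pow by blast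
    qed
    with bs False show ?thesis by (simp add: a_def)
  qed
qed (simp add: sk_mseq_def)

text \<open>A semisimplicity argument: compare the degrees of \<open>lclm (W, sk_lin b)\<close> and \<open>lclm (W, G)\<close>
  for a right divisor \<open>W\<close> of the class polynomial that is coprime to \<open>G\<close> and of maximal degree.\<close>

lemma rdvd_class_poly_unique_root:
  assumes G: "G rdvd class_poly a" and root: "\<And>d. sk_lin d rdvd G \<Longrightarrow> d = b"
  shows "degree G \<le> 1"
proof (rule ccontr)
  assume dG: "\<not> degree G \<le> 1"
  let ?P = "class_poly a"
  obtain bs where bs: "?P = sk_Pseq \<sigma> \<delta> bs" using class_poly_eq_sk_Pseq by blast
  have G0: "G \<noteq> 0" using dG by auto
  obtain d where "sk_lin d rdvd G"
    using rdvd_sk_Pseq_has_sk_lin[of G bs] G dG bs by auto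
  then have b: "sk_lin b rdvd G" using root by blast
  have bP: "sk_lin b rdvd ?P" using b G rdvd_trans by blast
  let ?Q = "\<lambda>W. W rdvd ?P \<and> coprime_right W G"
  have "coprime_right [:1:] G"
    unfolding coprime_right_def by (rule exI[of _ "[:1:]"], rule exI[of _ 0]) simp
  then have "?Q [:1:]" by (simp add: rdvd_const)
  moreover have "\<forall>W. ?Q W \<longrightarrow> degree W < Suc (degree ?P)"
    using rdvd_imp_degree_le[OF _ class_poly_neq_0] by (simp add: less_Suc_eq_le)
  ultimately have "\<exists>W. ?Q W \<and> (\<forall>V. ?Q V \<longrightarrow> degree V \<le> degree W)"
    by (rule ex_has_greatest_nat)
  then obtain W where "?Q W \<and> (\<forall>V. ?Q V \<longrightarrow> degree V \<le> degree W)" by (rule exE)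
  then have W: "W rdvd ?P" "coprime_right W G"
    and W_max: "\<And>V. V rdvd ?P \<Longrightarrow> coprime_right V G \<Longrightarrow> degree V \<le> degree W" by simp_all
  have W0: "W \<noteq> 0" using W(1) by (auto simp: sk_rdvd_def)
  have bW: "\<not> sk_lin b rdvd W"
    using coprime_right_common_divisor[OF W(2) _ b] by auto
  obtain b' where b': "sk_lin b rdvd sk_lin b' \<odot> W"
    "\<And>F. W rdvd F \<Longrightarrow> sk_lin b rdvd F \<Longrightarrow> sk_lin b' \<odot> W rdvd F"
    using lclm_sk_lin[OF W0 bW] by blast
  have "sk_lin c rdvd sk_lin b' \<odot> W" if c: "c \<in> sk_C \<sigma> \<delta> a" for c
  proof (cases "sk_lin c rdvd W")
    case True
    then show ?thesis by (rule rdvd_times_left)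
  next
    case False
    then obtain c' where c': "sk_lin c rdvd sk_lin c' \<odot> W"
      "\<And>F. W rdvd F \<Longrightarrow> sk_lin c rdvd F \<Longrightarrow> sk_lin c' \<odot> W rdvd F"
      using lclm_sk_lin[OF W0] by blast
    have V: "sk_lin c' \<odot> W rdvd ?P"
      using c'(2) W(1) c sk_lin_rdvd_class_poly by blast
    \<comment> \<open>By maximality of \<open>W\<close>, this lclm shares a root with
      \<open>G\<close>, which can only be \<open>b\<close>. So it is also the lclm of
      \<open>W\<close> and \<open>sk_lin b\<close>.\<close>
    have "\<not> coprime_right (sk_lin c' \<odot> W) G"
      using W_max[OF V] W0 by (auto simp: degree_skew_times)
    then have "sk_lin b rdvd sk_lin c' \<odot> W"
      using coprime_right_sk_PseqI[of "sk_lin c' \<odot> W" bs G] V bs W0 G0 root by auto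
    then have "sk_lin b' \<odot> W rdvd sk_lin c' \<odot> W" using b'(2) by simp
    then have "b' = c'" using W0 by (simp add: rdvd_times_cancel)
    with c'(1) show ?thesis by simp
  qed
  \<comment> \<open>One factor beyond \<open>W\<close> exhausts the class, whereas coprimality
    bounds \<open>degree W + degree G\<close> by \<open>degree ?P\<close>.\<close>
  then have "?P rdvd sk_lin b' \<odot> W" by (rule class_poly_rdvd)
  then have le: "degree ?P \<le> Suc (degree W)"
    using rdvd_imp_degree_le[of ?P "sk_lin b' \<odot> W"] W0 by (simp add: degree_skew_times)
  obtain L where L: "\<And>F. W rdvd F \<Longrightarrow> G rdvd F \<Longrightarrow> L rdvd F" "degree L = degree W + degree G"
    using coprime_right_lclm[OF W0 G0 W(2)] by blast
  have "degree L \<le> degree ?P"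
    using L(1)[OF W(1) G] by (rule rdvd_imp_degree_le) simp
  with le L(2) dG show False by simp
qed

section \<open>Lifting P-independence from roots to multiplicity sequences\<close>

text \<open>The gcrd of the two polynomials right-divides \<open>class_poly a\<close> and has no
  root other than \<open>hd bs\<close>, so \<open>rdvd_class_poly_unique_root\<close> makes it
  \<open>sk_lin (hd bs)\<close> up to a unit.\<close>

lemma sk_lin_hd_bezout:
  assumes "sk_mseq \<sigma> \<delta> bs" "hd bs \<in> sk_C \<sigma> \<delta> a"
  shows "\<exists>u v. sk_lin (hd bs) = u \<odot> class_poly a + v \<odot> sk_Pseq \<sigma> \<delta> bs"
proof -
  let ?P = "class_poly a" and ?A = "sk_Pseq \<sigma> \<delta> bs"
  obtain D u v where D: "D rdvd ?P" "D rdvd ?A" "D \<noteq> 0" and uv: "D = u \<odot> ?P + v \<odot> ?A"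
    using gcrd_lclm[OF class_poly_neq_0 sk_Pseq_neq_0, of a bs] by blast
  have "d = hd bs" if "sk_lin d rdvd D" for d
    using assms(1) rdvd_trans[OF that D(2)] unfolding sk_mseq_iff by blast
  then have deg: "degree D \<le> 1" by (rule rdvd_class_poly_unique_root[OF D(1)])
  have "sk_lin (hd bs) rdvd ?A" using assms(1) unfolding sk_mseq_def by blast
  then have "sk_lin (hd bs) rdvd D"
    unfolding uv using sk_lin_rdvd_class_poly[OF assms(2)] by (simp add: rdvd_add rdvd_times_left)
  then have "D rdvd sk_lin (hd bs)"
    using D(3) by (rule rdvd_same_degree) (use deg in simp)
  then obtain w where "sk_lin (hd bs) = w \<odot> D" unfolding sk_rdvd_def by blast
  then have "sk_lin (hd bs) = (w \<odot> u) \<odot> ?P + (w \<odot> v) \<odot> ?A"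
    by (simp only: uv skew_times_add_right skew_times_assoc)
  then show ?thesis by blast
qed

text \<open>The second conjunct says that \<open>P\<close> and the lclm generate the left ideal of all polynomials
  vanishing on \<open>B\<close>, so that adjoining a root outside the closure of \<open>B\<close> keeps coprimality.\<close>

lemma multiplicity_independent:
  assumes "finite B" "B \<subseteq> sk_C \<sigma> \<delta> a" "degree (sk_minS \<sigma> \<delta> B) = card B"
    and "\<And>b. b \<in> B \<Longrightarrow> sk_mseq \<sigma> \<delta> (s b) \<and> hd (s b) = b"
  shows "degree (sk_min \<sigma> \<delta> ((\<lambda>b. sk_Pseq \<sigma> \<delta> (s b)) ` B)) = (\<Sum>b\<in>B. length (s b)) \<and>
    (\<forall>z. (\<forall>b\<in>B. sk_lin b rdvd z) \<longrightarrow>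
      (\<exists>u v. z = u \<odot> class_poly a + v \<odot> sk_min \<sigma> \<delta> ((\<lambda>b. sk_Pseq \<sigma> \<delta> (s b)) ` B)))"
  using assms
proof (induction B rule: finite_induct)
  case empty
  have "z = 0 \<odot> class_poly a + z \<odot> [:1:]" for z by simp
  then show ?case by (metis degree_pCons_0 image_empty sk_min_empty sum.empty)
next
  case (insert c B)
  let ?P = "class_poly a" and ?A = "sk_Pseq \<sigma> \<delta> (s c)"
  let ?\<Omega> = "(\<lambda>b. sk_Pseq \<sigma> \<delta> (s b)) ` B"
  let ?L = "sk_min \<sigma> \<delta> ?\<Omega>"
  have ind: "degree (sk_minS \<sigma> \<delta> B) = card B" "\<not> sk_lin c rdvd sk_minS \<sigma> \<delta> B"
    using sk_minS_independent_insertD[OF insert.hyps insert.prems(2)] by blast+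
  have IH: "degree ?L = (\<Sum>b\<in>B. length (s b))"
    and IH2: "\<And>z. (\<forall>b\<in>B. sk_lin b rdvd z) \<Longrightarrow> \<exists>u v. z = u \<odot> ?P + v \<odot> ?L"
    using insert.IH insert.prems ind(1) by auto
  have alg: "sk_algebraic \<sigma> \<delta> (insert ?A ?\<Omega>)"
    using insert.hyps by (intro finite_imp_sk_algebraic) (auto dest: sym)
  then have alg': "sk_algebraic \<sigma> \<delta> ?\<Omega>" by (auto simp: sk_algebraic_iff)
  have L0: "?L \<noteq> 0" using lead_coeff_sk_min[OF alg'] by auto
  have c: "c \<in> sk_C \<sigma> \<delta> a" "sk_mseq \<sigma> \<delta> (s c)" "hd (s c) = c" using insert.prems by auto
  \<comment> \<open>Otherwise \<open>c\<close> would be a root of every combination of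
    \<open>?P\<close> and \<open>?L\<close>, in particular of the minimal polynomial of
    \<open>B\<close>, against independence.\<close>
  have "\<not> sk_lin c rdvd ?L"
  proof
    assume "sk_lin c rdvd ?L"
    moreover obtain u v where "sk_minS \<sigma> \<delta> B = u \<odot> ?P + v \<odot> ?L"
      using IH2[of "sk_minS \<sigma> \<delta> B"] sk_lin_rdvd_sk_minS[OF insert.hyps(1)] by blast
    ultimately show False
      using ind(2) sk_lin_rdvd_class_poly[OF c(1)] by (simp add: rdvd_add rdvd_times_left)
  qed
  then have "coprime_right ?A ?L"
    using c L0 by (intro coprime_right_sk_PseqI[OF rdvd_refl]) (auto simp: sk_mseq_iff)
  then have cop: "coprime_right ?L ?A" unfolding coprime_right_def by (metis add.commute)
  have "degree (sk_min \<sigma> \<delta> (insert ?A ?\<Omega>)) = (\<Sum>b\<in>insert c B. length (s b))"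
    using degree_sk_min_insert_coprime[OF alg _ cop] IH insert.hyps by simp
  moreover have "\<exists>u v. z = u \<odot> ?P + v \<odot> sk_min \<sigma> \<delta> (insert ?A ?\<Omega>)"
    if z: "\<forall>b\<in>insert c B. sk_lin b rdvd z" for z
  proof -
    obtain u v where uv: "z = u \<odot> ?P + v \<odot> ?L" using IH2 z by blast
    obtain x where x: "z = x \<odot> sk_lin c" using z unfolding sk_rdvd_def by blast
    obtain u' v' where "sk_lin c = u' \<odot> ?P + v' \<odot> ?A" using sk_lin_hd_bezout c by metis
    then have "z = (x \<odot> u') \<odot> ?P + (x \<odot> v') \<odot> ?A"
      by (simp only: x skew_times_add_right skew_times_assoc)
    \<comment> \<open>Vanishing on \<open>B\<close> and at \<open>c\<close> gives two
      representations of \<open>z\<close> modulo \<open>?P\<close>, through \<open>?L\<close> and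
      \<open>?A\<close>; the modular law merges them into one through a common left multiple
      \<open>w\<close>.\<close>
    from two_sided_modular[OF class_poly_rdvd_times[OF rdvd_refl] cop uv this]
    obtain p w where w: "z = p \<odot> ?P + w" "?L rdvd w" "?A rdvd w" by blast
    have "sk_min \<sigma> \<delta> (insert ?A ?\<Omega>) rdvd w"
      using w(3) rdvd_trans[OF rdvd_sk_min[OF alg'] w(2)] by (intro sk_min_rdvd[OF alg]) blast
    with w(1) show ?thesis unfolding sk_rdvd_def by blast
  qed
  ultimately show ?case by simp
qed

section \<open>Existence of multiplicity sequences of every length\<close>

lemma sk_mseq_extend:
  assumes "sk_mseq \<sigma> \<delta> bs"
  shows "\<exists>c. sk_mseq \<sigma> \<delta> (bs @ [c])"
proof (rule ccontr)
  assume nex: "\<nexists>c. sk_mseq \<sigma> \<delta> (bs @ [c])"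
  define a where "a = hd bs"
  let ?P = "class_poly a" and ?A = "sk_Pseq \<sigma> \<delta> bs"
  have bs: "bs \<noteq> []" using assms by (simp add: sk_mseq_def)
  have a: "sk_lin a rdvd ?A" "sk_lin a rdvd ?P"
    using assms sk_lin_rdvd_class_poly[OF self_in_sk_C] by (simp_all add: sk_mseq_def a_def)
  obtain D L u v where D: "D = u \<odot> ?A + v \<odot> ?P" "D \<noteq> 0"
    and L: "?A rdvd L" "?P rdvd L" "L \<noteq> 0"
    and deg: "degree D + degree L = degree ?A + degree ?P"
    using gcrd_lclm[OF sk_Pseq_neq_0 class_poly_neq_0, of bs a] by blast
  have "sk_lin a rdvd D" unfolding D(1) using a by (simp add: rdvd_add rdvd_times_left)
  then have "degree D \<ge> 1" using rdvd_imp_degree_le[OF _ D(2)] by fastforce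
  obtain w where w: "L = w \<odot> ?A" using L(1) unfolding sk_rdvd_def by blast
  have "sk_lin b rdvd w" if b: "b \<in> sk_C \<sigma> \<delta> a" for b
  proof -
    \<comment> \<open>Failure to prolong by \<open>b\<close> yields a second root \<open>d\<close>.
      As \<open>?A\<close> lacks this root, \<open>sk_lin b \<odot> ?A\<close> is the lclm of
      \<open>?A\<close> and \<open>sk_lin d\<close>, so it right-divides \<open>L\<close>.\<close>
    obtain d where d: "sk_lin d rdvd sk_lin b \<odot> ?A" "d \<noteq> a"
      using nex bs unfolding sk_mseq_iff by (auto simp: a_def)
    have "set (bs @ [b]) \<subseteq> sk_C \<sigma> \<delta> a"
      using sk_mseq_same_class[OF assms] b by (simp add: a_def)
    then have "d \<in> sk_C \<sigma> \<delta> a"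
      using d(1) by (intro sk_lin_rdvd_sk_Pseq_class[of "bs @ [b]"]) simp_all
    then have "sk_lin d rdvd L" using sk_lin_rdvd_class_poly L(2) rdvd_trans by blast
    have "\<not> sk_lin d rdvd ?A" using d(2) assms unfolding sk_mseq_iff a_def by blast
    then obtain b' where b': "\<And>F. ?A rdvd F \<Longrightarrow> sk_lin d rdvd F \<Longrightarrow> sk_lin b' \<odot> ?A rdvd F"
      using lclm_sk_lin[OF sk_Pseq_neq_0] by blast
    have "sk_lin b' \<odot> ?A rdvd sk_lin b \<odot> ?A" using b' d(1) by simp
    then have "b' = b" by (simp add: rdvd_times_cancel)
    then have "sk_lin b \<odot> ?A rdvd w \<odot> ?A"
      using b'[OF L(1) \<open>sk_lin d rdvd L\<close>] w by simp
    then show ?thesis by (simp add: rdvd_times_cancel)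
  qed
  then have "?P rdvd w" by (rule class_poly_rdvd)
  moreover have "w \<noteq> 0" using w L(3) by auto
  ultimately have "degree ?P \<le> degree w" by (rule rdvd_imp_degree_le)
  then have "degree ?P + degree ?A \<le> degree L" using \<open>w \<noteq> 0\<close> by (simp add: w degree_skew_times)
  with deg \<open>degree D \<ge> 1\<close> show False by simp
qed

lemma sk_mseq_exists: "\<exists>bs. sk_mseq \<sigma> \<delta> bs \<and> length bs = Suc n \<and> hd bs = b"
proof (induction n)
  case 0
  show ?case by (rule exI[of _ "[b]"]) (simp add: sk_mseq_singleton)
next
  case (Suc n)
  then obtain bs where bs: "sk_mseq \<sigma> \<delta> bs" "length bs = Suc n" "hd bs = b" by blast
  then obtain c where "sk_mseq \<sigma> \<delta> (bs @ [c])" using sk_mseq_extend by blast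
  moreover have "bs \<noteq> []" using bs(2) by auto
  ultimately show ?case using bs by (intro exI[of _ "bs @ [c]"]) simp
qed

section \<open>Completion to P-bases and the bound on lengths\<close>

text \<open>Independent subsets of the class have at most \<open>degree (class_poly a)\<close>
  elements. A largest one containing \<open>b\<close> misses no root, because a missed root could be
  adjoined.\<close>

lemma class_basis_containing:
  assumes "b \<in> sk_C \<sigma> \<delta> a"
  shows "\<exists>B. finite B \<and> b \<in> B \<and> B \<subseteq> sk_C \<sigma> \<delta> a \<and> degree (sk_minS \<sigma> \<delta> B) = card B \<and>
    degree (class_poly a) = card B"
proof -
  let ?Q = "\<lambda>B. finite B \<and> b \<in> B \<and> B \<subseteq> sk_C \<sigma> \<delta> a \<and> degree (sk_minS \<sigma> \<delta> B) = card B"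
  have dvd: "sk_minS \<sigma> \<delta> B rdvd class_poly a" if "finite B" "B \<subseteq> sk_C \<sigma> \<delta> a" for B
    using that by (intro sk_minS_rdvd sk_lin_rdvd_class_poly) auto
  have "sk_minS \<sigma> \<delta> {b} = sk_lin b"
    unfolding sk_minS_def by (rule sk_min_eqI) simp_all
  then have "?Q {b}" using assms by simp
  moreover have "\<forall>B. ?Q B \<longrightarrow> card B < Suc (degree (class_poly a))"
    using rdvd_imp_degree_le[OF dvd class_poly_neq_0] by (metis less_Suc_eq_le)
  ultimately have "\<exists>B. ?Q B \<and> (\<forall>B'. ?Q B' \<longrightarrow> card B' \<le> card B)"
    by (rule ex_has_greatest_nat)
  then obtain B where "?Q B \<and> (\<forall>B'. ?Q B' \<longrightarrow> card B' \<le> card B)" by (rule exE)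
  then have B: "?Q B" and B_max: "\<And>B'. ?Q B' \<Longrightarrow> card B' \<le> card B" by simp_all
  have "class_poly a rdvd sk_minS \<sigma> \<delta> B"
  proof (rule class_poly_rdvd, rule ccontr)
    fix c assume c: "c \<in> sk_C \<sigma> \<delta> a" "\<not> sk_lin c rdvd sk_minS \<sigma> \<delta> B"
    then have "c \<notin> B" using B sk_lin_rdvd_sk_minS by blast
    moreover have "?Q (insert c B)"
      using B c \<open>c \<notin> B\<close> degree_sk_minS_insert[of B c] by simp
    ultimately show False using B_max[of "insert c B"] B by simp
  qed
  moreover have "sk_minS \<sigma> \<delta> B \<noteq> 0" using lead_coeff_sk_minS[of B] B by auto
  ultimately have "degree (class_poly a) \<le> card B"
    using rdvd_imp_degree_le[of "class_poly a" "sk_minS \<sigma> \<delta> B"] B by simp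
  moreover have "card B \<le> degree (class_poly a)"
    using rdvd_imp_degree_le[OF dvd class_poly_neq_0] B by metis
  ultimately show ?thesis using B by (intro exI[of _ B]) simp
qed

lemma class_pow_mono: "i \<le> j \<Longrightarrow> class_pow a i rdvd class_pow a j"
proof (induction j)
  case (Suc j)
  then show ?case by (cases "i = Suc j") (auto simp: rdvd_times_left)
qed simp

lemma sk_mseq_rdvd_class_pow:
  assumes "sk_mseq \<sigma> \<delta> bs" "hd bs \<in> sk_C \<sigma> \<delta> a" "length bs \<le> r"
  shows "sk_Pseq \<sigma> \<delta> bs rdvd class_pow a r"
proof -
  have "set bs \<subseteq> sk_C \<sigma> \<delta> a" using sk_mseq_same_class[OF assms(1)] sk_C_eq[OF assms(2)] by simp
  then have "sk_Pseq \<sigma> \<delta> bs rdvd class_pow a (length bs)" by (rule sk_Pseq_rdvd_class_pow)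
  then show ?thesis using class_pow_mono[OF assms(3)] by (rule rdvd_trans)
qed

text \<open>Complete \<open>hd bs\<close> to a P-basis and attach sequences of length \<open>r\<close> to the other basis elements:
  the resulting independent family still right-divides \<open>class_pow a r\<close>.\<close>

lemma sk_mseq_length_le:
  assumes "sk_mseq \<sigma> \<delta> bs" "sk_Pseq \<sigma> \<delta> bs rdvd class_pow a r" "r \<ge> 1"
  shows "hd bs \<in> sk_C \<sigma> \<delta> a" "length bs \<le> r"
proof -
  have "sk_lin (hd bs) rdvd class_pow a r"
    using assms(1,2) rdvd_trans unfolding sk_mseq_def by blast
  then show a: "hd bs \<in> sk_C \<sigma> \<delta> a" by (rule sk_lin_rdvd_class_pow)
  obtain B where B: "finite B" "hd bs \<in> B" "B \<subseteq> sk_C \<sigma> \<delta> a" "degree (sk_minS \<sigma> \<delta> B) = card B"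
    "degree (class_poly a) = card B"
    using class_basis_containing[OF a] by blast
  \<comment> \<open>\<open>sk_mseq_exists\<close> produces length \<open>Suc n\<close>; with
    \<open>r \<ge> 1\<close>, taking \<open>n = r - 1\<close> gives length \<open>r\<close>.\<close>
  obtain t where t: "\<And>b. sk_mseq \<sigma> \<delta> (t b) \<and> length (t b) = r \<and> hd (t b) = b"
    using sk_mseq_exists[of "r - 1"] assms(3) by (metis One_nat_def Suc_pred less_eq_Suc_le)
  define s where "s = t(hd bs := bs)"
  have s: "sk_mseq \<sigma> \<delta> (s b) \<and> hd (s b) = b" for b using t assms(1) by (simp add: s_def)
  let ?\<Omega> = "(\<lambda>b. sk_Pseq \<sigma> \<delta> (s b)) ` B"
  have "degree (sk_min \<sigma> \<delta> ?\<Omega>) = (\<Sum>b\<in>B. length (s b))"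
    using multiplicity_independent[OF B(1,3,4), of s] s by blast
  also have "\<dots> = length (s (hd bs)) + (\<Sum>b\<in>B - {hd bs}. length (s b))"
    using B by (simp add: sum.remove)
  also have "(\<Sum>b\<in>B - {hd bs}. length (s b)) = (\<Sum>b\<in>B - {hd bs}. r)"
    using t by (intro sum.cong) (auto simp: s_def)
  finally have deg: "degree (sk_min \<sigma> \<delta> ?\<Omega>) = length bs + r * (card B - 1)"
    using B by (simp add: s_def)
  have dvd: "Q rdvd class_pow a r" if Q: "Q \<in> ?\<Omega>" for Q
  proof -
    obtain b where b: "b \<in> B" "Q = sk_Pseq \<sigma> \<delta> (s b)" using Q by blast
    show ?thesis
    proof (cases "b = hd bs")
      case False
      then show ?thesis
        using sk_mseq_rdvd_class_pow[of "t b" a r] t[of b] B(3) b by (auto simp: s_def)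
    qed (use b assms(2) in \<open>simp add: s_def\<close>)
  qed
  then have "sk_algebraic \<sigma> \<delta> ?\<Omega>" unfolding sk_algebraic_iff using class_pow_neq_0 by blast
  then have "sk_min \<sigma> \<delta> ?\<Omega> rdvd class_pow a r" using dvd by (rule sk_min_rdvd)
  then have "degree (sk_min \<sigma> \<delta> ?\<Omega>) \<le> degree (class_pow a r)"
    by (rule rdvd_imp_degree_le) simp
  then have "length bs + r * (card B - 1) \<le> r * card B" by (simp add: deg degree_class_pow B(5))
  \<comment> \<open>\<open>B\<close> contains \<open>hd bs\<close>, so the natural-number
    subtraction \<open>card B - 1\<close> is exact and the inequality collapses to the
    claim.\<close>
  moreover obtain k where "card B = Suc k" using B(1,2) by (metis card_Suc_Diff1)
  ultimately show "length bs \<le> r" by simp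
qed

section \<open>Zero sets, minimal polynomials and P-bases for multiplicity sequences\<close>

text \<open>Under these hypotheses the zero set consists of the right divisors of
  \<open>class_pow a r\<close> in \<open>sk_U2 \<sigma> \<delta>\<close>. The lemma serves both the
  ideal of the closed set and the ideal of a candidate P-basis.\<close>

lemma sk_Z_eq_sk_Cr:
  assumes "class_pow a r \<in> A" "\<And>F. F \<in> A \<Longrightarrow> class_pow a r rdvd F" "r \<ge> 1"
  shows "sk_Z \<sigma> \<delta> A = sk_Cr \<sigma> \<delta> r a"
proof (intro equalityI subsetI)
  fix Q assume "Q \<in> sk_Z \<sigma> \<delta> A"
  then obtain bs where bs: "sk_mseq \<sigma> \<delta> bs" "Q = sk_Pseq \<sigma> \<delta> bs" "Q rdvd class_pow a r"
    using assms(1) unfolding sk_Z_def sk_U2_def by blast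
  moreover from bs have "hd bs \<in> sk_C \<sigma> \<delta> a" "length bs \<le> r"
    using sk_mseq_length_le assms(3) by blast+
  moreover have "1 \<le> length bs" using bs(1) by (cases bs) (auto simp: sk_mseq_def)
  ultimately show "Q \<in> sk_Cr \<sigma> \<delta> r a" unfolding sk_Cr_def by blast
next
  fix Q assume "Q \<in> sk_Cr \<sigma> \<delta> r a"
  then obtain bs where bs: "sk_mseq \<sigma> \<delta> bs" "Q = sk_Pseq \<sigma> \<delta> bs" "hd bs \<in> sk_C \<sigma> \<delta> a" "length bs \<le> r"
    unfolding sk_Cr_def by blast
  then have "Q rdvd class_pow a r" using sk_mseq_rdvd_class_pow by simp
  then show "Q \<in> sk_Z \<sigma> \<delta> A" using bs(1,2) rdvd_trans[OF _ assms(2)] unfolding sk_Z_def sk_U2_def by blast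
qed

lemma sk_min_multiplicity_basis:
  fixes as :: "nat \<Rightarrow> 'a"
  assumes inj: "inj_on as {..<m}" and basis: "sk_Pbasis_class \<sigma> \<delta> (as ` {..<m}) a"
    and s: "\<And>i. i < m \<Longrightarrow> sk_mseq \<sigma> \<delta> (s i) \<and> length (s i) = r \<and> hd (s i) = as i"
  shows "sk_min \<sigma> \<delta> ((\<lambda>i. sk_Pseq \<sigma> \<delta> (s i)) ` {..<m}) = class_pow a r"
    and "sk_Pindep \<sigma> \<delta> ((\<lambda>i. sk_Pseq \<sigma> \<delta> (s i)) ` {..<m})"
proof -
  let ?B = "as ` {..<m}" and ?\<Omega> = "(\<lambda>i. sk_Pseq \<sigma> \<delta> (s i)) ` {..<m}"
  \<comment> \<open>The sequences are reindexed by the basis elements, as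
    \<open>multiplicity_independent\<close> expects; injectivity of \<open>as\<close> recovers the
    index.\<close>
  define t where "t b = s (the_inv_into {..<m} as b)" for b
  have t: "t (as i) = s i" if "i < m" for i
    using that inj by (simp add: t_def the_inv_into_f_f)
  have \<Omega>: "?\<Omega> = (\<lambda>b. sk_Pseq \<sigma> \<delta> (t b)) ` ?B"
    unfolding image_image by (rule image_cong) (simp_all add: t)
  have card: "card ?B = m" using inj by (simp add: card_image)
  have B: "?B \<subseteq> sk_C \<sigma> \<delta> a" "sk_minS \<sigma> \<delta> ?B = class_poly a"
    and "degree (sk_minS \<sigma> \<delta> ?B) = (\<Sum>Q\<in>sk_lin ` ?B. degree Q)"
    using basis unfolding sk_Pbasis_class_def sk_Pindep_def sk_minS_def by blast+
  moreover have "(\<Sum>Q\<in>sk_lin ` ?B. degree Q) = card ?B"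
    by (subst sum.reindex) (auto simp: inj_on_def)
  ultimately have deg: "degree (sk_minS \<sigma> \<delta> ?B) = card ?B" by simp
  have "sk_mseq \<sigma> \<delta> (t b) \<and> hd (t b) = b" if "b \<in> ?B" for b
    using that s t by auto
  from multiplicity_independent[OF _ B(1) deg this]
  have "degree (sk_min \<sigma> \<delta> ?\<Omega>) = (\<Sum>b\<in>?B. length (t b))"
    unfolding \<Omega> by simp
  also have "\<dots> = (\<Sum>b\<in>?B. r)" by (rule sum.cong) (use s t in auto)
  finally have deg_min: "degree (sk_min \<sigma> \<delta> ?\<Omega>) = r * m" using card by simp
  have dvd: "Q rdvd class_pow a r" if "Q \<in> ?\<Omega>" for Q
    using that s B(1) sk_mseq_rdvd_class_pow by auto
  then have alg: "sk_algebraic \<sigma> \<delta> ?\<Omega>" unfolding sk_algebraic_iff using class_pow_neq_0 by blast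
  have "sk_min \<sigma> \<delta> ?\<Omega> rdvd class_pow a r" using alg dvd by (rule sk_min_rdvd)
  then show "sk_min \<sigma> \<delta> ?\<Omega> = class_pow a r"
    using lead_coeff_sk_min[OF alg] lead_coeff_sk_pow[OF lead_coeff_class_poly]
    by (rule rdvd_same_degree_monic_eq)
      (use deg_min deg card B(2) in \<open>simp add: degree_class_pow\<close>)
  \<comment> \<open>P-independence sums degrees over a set, so coinciding polynomials must be
    excluded: each determines its head as its unique root.\<close>
  have "inj_on (\<lambda>i. sk_Pseq \<sigma> \<delta> (s i)) {..<m}"
  proof (rule inj_onI)
    fix i j assume ij: "i \<in> {..<m}" "j \<in> {..<m}" "sk_Pseq \<sigma> \<delta> (s i) = sk_Pseq \<sigma> \<delta> (s j)"
    then have "as i = as j" using s[of i] s[of j] unfolding sk_mseq_def by (metis lessThan_iff)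
    then show "i = j" using inj ij by (simp add: inj_on_eq_iff)
  qed
  then have "(\<Sum>Q\<in>?\<Omega>. degree Q) = r * m" using s by (simp add: sum.reindex)
  then show "sk_Pindep \<sigma> \<delta> ?\<Omega>" unfolding sk_Pindep_def using alg deg_min by simp
qed

end

theorem mainTheorem15:
  fixes \<sigma> \<delta> :: "'a::division_ring \<Rightarrow> 'a" and a :: 'a and r m :: nat and as :: "nat \<Rightarrow> 'a"
  assumes "sk_endo \<sigma>" and "sk_sder \<sigma> \<delta>"
    and "\<forall>c. sk_algebraic \<sigma> \<delta> (sk_lin ` sk_C \<sigma> \<delta> c)"
    and "r \<ge> 1"
    and "inj_on as {..<m}"
    and "sk_Pbasis_class \<sigma> \<delta> (as ` {..<m}) a"
  shows
    "(\<forall>bs. sk_mseq \<sigma> \<delta> bs \<and> length bs = r \<and> hd bs \<in> sk_C \<sigma> \<delta> a \<longrightarrow>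
        sk_rdvd \<sigma> \<delta> (sk_Pseq \<sigma> \<delta> bs) (sk_pow \<sigma> \<delta> (sk_minS \<sigma> \<delta> (sk_C \<sigma> \<delta> a)) r))
   \<and> (\<forall>s. (\<forall>i<m. sk_mseq \<sigma> \<delta> (s i) \<and> length (s i) = r \<and> hd (s i) = as i) \<longrightarrow>
        sk_min \<sigma> \<delta> ((\<lambda>i. sk_Pseq \<sigma> \<delta> (s i)) ` {..<m})
          = sk_pow \<sigma> \<delta> (sk_minS \<sigma> \<delta> (sk_C \<sigma> \<delta> a)) r)
   \<and> sk_Cr \<sigma> \<delta> r a \<subseteq> sk_U2 \<sigma> \<delta>
   \<and> sk_Pclosed \<sigma> \<delta> (sk_Cr \<sigma> \<delta> r a)
   \<and> sk_min \<sigma> \<delta> (sk_Cr \<sigma> \<delta> r a) = sk_pow \<sigma> \<delta> (sk_minS \<sigma> \<delta> (sk_C \<sigma> \<delta> a)) r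
   \<and> (\<forall>s. (\<forall>i<m. sk_mseq \<sigma> \<delta> (s i) \<and> length (s i) = r \<and> hd (s i) = as i) \<longrightarrow>
        sk_Pbasis \<sigma> \<delta> ((\<lambda>i. sk_Pseq \<sigma> \<delta> (s i)) ` {..<m}) (sk_Cr \<sigma> \<delta> r a))
   \<and> sk_rank \<sigma> \<delta> (sk_Cr \<sigma> \<delta> r a) = degree (sk_pow \<sigma> \<delta> (sk_minS \<sigma> \<delta> (sk_C \<sigma> \<delta> a)) r)
   \<and> degree (sk_pow \<sigma> \<delta> (sk_minS \<sigma> \<delta> (sk_C \<sigma> \<delta> a)) r) = r * degree (sk_minS \<sigma> \<delta> (sk_C \<sigma> \<delta> a))"
proof -
  interpret algebraic_skew_poly \<sigma> \<delta>
    using assms(1-3) by unfold_locales blast+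
  let ?\<Omega> = "\<lambda>s. (\<lambda>i. sk_Pseq \<sigma> \<delta> (s i)) ` {..<m}" and ?Cr = "sk_Cr \<sigma> \<delta> r a"
  let ?ok = "\<lambda>s. \<forall>i<m. sk_mseq \<sigma> \<delta> (s i) \<and> length (s i) = r \<and> hd (s i) = as i"
  have min_\<Omega>: "sk_min \<sigma> \<delta> (?\<Omega> s) = class_pow a r" and indep: "sk_Pindep \<sigma> \<delta> (?\<Omega> s)" if "?ok s" for s
    using sk_min_multiplicity_basis[OF assms(5,6), of s r] that by blast+
  have as: "as i \<in> sk_C \<sigma> \<delta> a" if "i < m" for i
    using assms(6) that unfolding sk_Pbasis_class_def by blast
  have sub: "?\<Omega> s \<subseteq> ?Cr" if "?ok s" for s
    using that as assms(4) unfolding sk_Cr_def by fastforce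
  have dvd: "Q rdvd class_pow a r" if "Q \<in> ?Cr" for Q
    using that sk_mseq_rdvd_class_pow unfolding sk_Cr_def by blast
  have I_\<Omega>: "class_pow a r rdvd F" if "?ok s" "F \<in> sk_I \<sigma> \<delta> (?\<Omega> s)" for s F
    using sk_min_rdvd[of "?\<Omega> s" F] indep[OF that(1)] that(2)
    unfolding min_\<Omega>[OF that(1)] sk_Pindep_def sk_I_iff by blast
  \<comment> \<open>This supplies one concrete family of the kind in part (2). As it lies in
    \<open>?Cr\<close>, a common left multiple of \<open>?Cr\<close> is one of the family too, hence
    a left multiple of \<open>class_pow a r\<close>.\<close>
  obtain t where t: "\<And>b. sk_mseq \<sigma> \<delta> (t b) \<and> length (t b) = r \<and> hd (t b) = b"
    using sk_mseq_exists[of "r - 1"] assms(4) by (metis One_nat_def Suc_pred less_eq_Suc_le)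
  then have ok: "?ok (\<lambda>i. t (as i))" by blast
  have I_Cr: "class_pow a r rdvd F" if "F \<in> sk_I \<sigma> \<delta> ?Cr" for F
    using I_\<Omega>[OF ok, of F] that sub[OF ok] unfolding sk_I_iff by blast
  have min_Cr: "sk_min \<sigma> \<delta> ?Cr = class_pow a r"
    using dvd I_Cr by (intro sk_min_eqI lead_coeff_sk_pow lead_coeff_class_poly) (auto simp: sk_I_iff)
  have U2: "?Cr \<subseteq> sk_U2 \<sigma> \<delta>" unfolding sk_Cr_def sk_U2_def by blast
  have "sk_Z \<sigma> \<delta> (sk_I \<sigma> \<delta> ?Cr) = ?Cr"
    by (rule sk_Z_eq_sk_Cr) (use dvd I_Cr assms(4) in \<open>auto simp: sk_I_iff\<close>)
  then have closed: "sk_Pclosed \<sigma> \<delta> ?Cr" unfolding sk_Pclosed_def using U2 by blast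
  have pbasis: "sk_Pbasis \<sigma> \<delta> (?\<Omega> s) ?Cr" if "?ok s" for s
    unfolding sk_Pbasis_def
  proof (intro conjI)
    show "sk_Pindep \<sigma> \<delta> (?\<Omega> s)" using that by (rule indep)
    show "sk_le \<sigma> \<delta> (?\<Omega> s) ?Cr"
      \<comment> \<open>The family already lies in \<open>?Cr\<close>, so each member can be matched
        with itself.\<close>
      unfolding sk_le_def using sub[OF that] by (intro allI impI exI[of _ id]) auto
    show "sk_Z \<sigma> \<delta> (sk_I \<sigma> \<delta> (?\<Omega> s)) = ?Cr"
    proof (rule sk_Z_eq_sk_Cr[OF _ I_\<Omega>[OF that] assms(4)])
      show "class_pow a r \<in> sk_I \<sigma> \<delta> (?\<Omega> s)" using dvd sub[OF that] unfolding sk_I_iff by blast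
    qed
  qed
  show ?thesis
    using sk_mseq_rdvd_class_pow min_\<Omega> U2 closed min_Cr pbasis degree_class_pow
    unfolding sk_rank_def by simp
qed

end
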